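(* Let $\mathcal{C}$ be a category with pullbacks and a terminal object, let $\tau$ be a Grothendieck topology on $\mathcal{C}$, let $G$ be a group object of $\mathcal{C}$, and let $X$ be an object of $\mathcal{C}$ with an action $x\colon G\times X\to X$ of $G$. Then the quotient prestack $[X/G]\colon\mathcal{C}^{\mathrm{op}}\to\mathrm{Cat}$ is a (well-defined) pseudofunctor.
   Context: For $f\colon P\to Y$ and $g\colon Z\to Y$, write $f^*g\colon P\times_Y Z\to P$ and $g^*f\colon P\times_Y Z\to Z$ for the projections of the (chosen) pullback. **Actions.** Let $G$ be a group object with multiplication $m\colon G\times G\to G$ and unit $e\colon T\to G$, with $T$ terminal. An action of $G$ on $X$ is a morphism $x\colon G\times X\to X$ with $x\circ(\mathrm{id}_G\times x)=x\circ(m\times \mathrm{id}_X)$ and $x\circ(e\times \mathrm{id}_X)=\mathrm{pr}_2\colon T\times X\to X$. If $G$ acts on $X$ and $Y$ by $x,y$, a morphism $f\colon X\to Y$ is $G$-equivariant if $f\circ x=y\circ(\mathrm{id}_G\times f)$. Objects for which no action is specified carry the trivial action (second projection). If $G$ acts on $P,Y,Z$ via $p,y,z$ and $f\colon P\to Y$, $g\colon Z\to Y$ are $G$-equivariant, then $P\times_Y Z$ carries the action $\psi\colon G\times(P\times_Y Z)\to P\times_Y Z$ determined by $f^*g\circ\psi=p\circ(\mathrm{id}_G\times f^*g)$ and $g^*f\circ\psi=z\circ(\mathrm{id}_G\times g^*f)$. **Principal bundles.** A principal $G$-bundle over $Y$ (in the site $(\mathcal{C},\tau)$) is an object $P$ with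 an action $p\colon G\times P\to P$ and a $G$-equivariant morphism $\pi_P\colon P\to Y$ ($Y$ with trivial action) that is locally trivial: there is a covering family $\{f_i\colon U_i\to Y\}_{i\in I}$ for $\tau$ such that for every $i$ there is a $G$-equivariant isomorphism $\phi_i\colon P\times_Y U_i\to G\times U_i$ over $U_i$ (i.e. $\mathrm{pr}_2\circ\phi_i=f_i^*\pi_P$), where $P\times_Y U_i$ has the pullback action above ($U_i$, $Y$ with trivial actions) and $G\times U_i$ has the action by multiplication $m$ on the first factor. A morphism of principal $G$-bundles over $Y$ from $\pi_P$ to $\pi_Q$ is a $G$-equivariant morphism $\phi\colon P\to Q$ with $\pi_Q\circ\phi=\pi_P$. **Quotient prestack.** For $Y\in\mathcal{C}$, $[X/G](Y)$ is the category whose objects are pairs $(P,\alpha)$ with $\pi_P\colon P\to Y$ a principal $G$-bundle over $Y$ and $\alpha\colon P\to X$ a $G$-equivariant morphism, and whose morphisms $(P,\alpha)\to(Q,\beta)$ are the morphisms of principal $G$-bundles $\phi\colon P\to Q$ with $\beta\circ\phi=\alpha$. For a morphism $f\colon Z\to Y$, $[X/G](f)\colon[X/G](Y)\to[X/G](Z)$ sends $(P,\alpha)$ to $(P\times_Y Z,\ \alpha\circ\pi_P^*f)$, with bundle morphism $f^*\pi_P\colon P\times_Y Z\to Z$ and the pullback action, and sends $\phi\colon(P,\alpha)\to(Q,\beta)$ to the unique morphism $P\times_Y Z\to Q\times_Y Z$ whose composites with $\pi_Q^*f$ and $f^*\pi_Q$ are $\phi\circ\pi_P^*f$ and $f^*\pi_P$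 respectively. The coherence isomorphisms of the pseudofunctor are the canonical isomorphisms between pullbacks. *)

theory Defs
  imports Main
begin

section \<open>Categories, functors, natural isomorphisms\<close>

record ('o, 'a) cat =
  Obj :: "'o set"
  Arr :: "'a set"
  Dom :: "'a \<Rightarrow> 'o"
  Cod :: "'a \<Rightarrow> 'o"
  Id :: "'o \<Rightarrow> 'a"
  Cmp :: "'a \<Rightarrow> 'a \<Rightarrow> 'a"  (infixr "\<cdot>\<index>" 70)

definition Hom :: "('o, 'a, 'z) cat_scheme \<Rightarrow> 'o \<Rightarrow> 'o \<Rightarrow> 'a set" where
  "Hom C A B = {f \<in> Arr C. Dom C f = A \<and> Cod C f = B}"

locale category =
  fixes C :: "('o, 'a, 'z) cat_scheme" (structure)
  assumes dom_in: "f \<in> Arr C \<Longrightarrow> Dom C f \<in> Obj C"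
    and cod_in: "f \<in> Arr C \<Longrightarrow> Cod C f \<in> Obj C"
    and id_in: "A \<in> Obj C \<Longrightarrow> Id C A \<in> Hom C A A"
    and comp_in: "\<lbrakk>f \<in> Hom C A B; g \<in> Hom C B D\<rbrakk> \<Longrightarrow> g \<cdot> f \<in> Hom C A D"
    and id_right: "f \<in> Hom C A B \<Longrightarrow> f \<cdot> Id C A = f"
    and id_left: "f \<in> Hom C A B \<Longrightarrow> Id C B \<cdot> f = f"
    and assoc: "\<lbrakk>f \<in> Hom C A B; g \<in> Hom C B D; h \<in> Hom C D E\<rbrakk>
      \<Longrightarrow> (h \<cdot> g) \<cdot> f = h \<cdot> (g \<cdot> f)"

definition op_cat :: "('o, 'a, 'z) cat_scheme \<Rightarrow> ('o, 'a) cat" where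
  "op_cat C = \<lparr>Obj = Obj C, Arr = Arr C, Dom = Cod C, Cod = Dom C, Id = Id C,
     Cmp = (\<lambda>g f. f \<cdot>\<^bsub>C\<^esub> g)\<rparr>"

definition is_iso :: "('o, 'a, 'z) cat_scheme \<Rightarrow> 'a \<Rightarrow> bool" where
  "is_iso C f \<longleftrightarrow> f \<in> Arr C \<and>
     (\<exists>g \<in> Hom C (Cod C f) (Dom C f).
        g \<cdot>\<^bsub>C\<^esub> f = Id C (Dom C f) \<and> f \<cdot>\<^bsub>C\<^esub> g = Id C (Cod C f))"

record ('p, 'q, 'r, 's) fctr =
  OMap :: "'p \<Rightarrow> 'r"
  AMap :: "'q \<Rightarrow> 's"

locale is_functor =
  A: category A + B: category B
  for A :: "('p, 'q, 'y) cat_scheme"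
    and B :: "('r, 's, 'z) cat_scheme"
    and F :: "('p, 'q, 'r, 's) fctr" +
  assumes obj_map: "a \<in> Obj A \<Longrightarrow> OMap F a \<in> Obj B"
    and arr_map: "f \<in> Hom A a b \<Longrightarrow> AMap F f \<in> Hom B (OMap F a) (OMap F b)"
    and id_map: "a \<in> Obj A \<Longrightarrow> AMap F (Id A a) = Id B (OMap F a)"
    and comp_map: "\<lbrakk>f \<in> Hom A a b; g \<in> Hom A b c\<rbrakk>
      \<Longrightarrow> AMap F (g \<cdot>\<^bsub>A\<^esub> f) = AMap F g \<cdot>\<^bsub>B\<^esub> AMap F f"

definition id_functor :: "('p, 'q, 'p, 'q) fctr" where
  "id_functor = \<lparr>OMap = (\<lambda>a. a), AMap = (\<lambda>f. f)\<rparr>"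

definition comp_functor ::
    "('r, 's, 't, 'u) fctr \<Rightarrow> ('p, 'q, 'r, 's) fctr \<Rightarrow> ('p, 'q, 't, 'u) fctr" where
  "comp_functor K F = \<lparr>OMap = OMap K \<circ> OMap F, AMap = AMap K \<circ> AMap F\<rparr>"

locale natural_iso =
  F: is_functor A B F + K: is_functor A B K
  for A :: "('p, 'q, 'y) cat_scheme"
    and B :: "('r, 's, 'z) cat_scheme"
    and F K :: "('p, 'q, 'r, 's) fctr"
    and \<eta> :: "'p \<Rightarrow> 's" +
  assumes component: "a \<in> Obj A \<Longrightarrow> \<eta> a \<in> Hom B (OMap F a) (OMap K a)"
    and component_iso: "a \<in> Obj A \<Longrightarrow> is_iso B (\<eta> a)"
    and natural: "f \<in> Hom A a b \<Longrightarrow> \<eta> b \<cdot>\<^bsub>B\<^esub> AMap F f = AMap K f \<cdot>\<^bsub>B\<^esub> \<eta> a"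


section \<open>Pseudofunctors from a category to Cat\<close>

text \<open>
  \<open>PUnit F a\<close> is the family of components of the 2-cell from the identity to
  \<open>F (Id a)\<close>, and \<open>PComp F g f\<close> that of the 2-cell from \<open>F g \<circ> F f\<close> to \<open>F (g \<cdot> f)\<close>.
\<close>

record ('o, 'a, 'p, 'q) pseudofun =
  PObj :: "'o \<Rightarrow> ('p, 'q) cat"
  PArr :: "'a \<Rightarrow> ('p, 'q, 'p, 'q) fctr"
  PUnit :: "'o \<Rightarrow> 'p \<Rightarrow> 'q"
  PComp :: "'a \<Rightarrow> 'a \<Rightarrow> 'p \<Rightarrow> 'q"

locale pseudofunctor_to_Cat =
  D: category D
  for D :: "('o, 'a, 'z) cat_scheme"
    and F :: "('o, 'a, 'p, 'q) pseudofun" +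
  assumes value_category: "a \<in> Obj D \<Longrightarrow> category (PObj F a)"
    and value_functor: "f \<in> Hom D a b \<Longrightarrow> is_functor (PObj F a) (PObj F b) (PArr F f)"
    and unit_iso: "a \<in> Obj D
      \<Longrightarrow> natural_iso (PObj F a) (PObj F a) id_functor (PArr F (Id D a)) (PUnit F a)"
    and comp_iso: "\<lbrakk>f \<in> Hom D a b; g \<in> Hom D b c\<rbrakk>
      \<Longrightarrow> natural_iso (PObj F a) (PObj F c)
            (comp_functor (PArr F g) (PArr F f)) (PArr F (g \<cdot>\<^bsub>D\<^esub> f)) (PComp F g f)"
    and right_unit: "\<lbrakk>f \<in> Hom D a b; s \<in> Obj (PObj F a)\<rbrakk>
      \<Longrightarrow> PComp F f (Id D a) s \<cdot>\<^bsub>PObj F b\<^esub> AMap (PArr F f) (PUnit F a s)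
          = Id (PObj F b) (OMap (PArr F f) s)"
    and left_unit: "\<lbrakk>f \<in> Hom D a b; s \<in> Obj (PObj F a)\<rbrakk>
      \<Longrightarrow> PComp F (Id D b) f s \<cdot>\<^bsub>PObj F b\<^esub> PUnit F b (OMap (PArr F f) s)
          = Id (PObj F b) (OMap (PArr F f) s)"
    and associativity:
      "\<lbrakk>f \<in> Hom D a b; g \<in> Hom D b c; h \<in> Hom D c d; s \<in> Obj (PObj F a)\<rbrakk>
      \<Longrightarrow> PComp F (h \<cdot>\<^bsub>D\<^esub> g) f s \<cdot>\<^bsub>PObj F d\<^esub> PComp F h g (OMap (PArr F f) s)
          = PComp F h (g \<cdot>\<^bsub>D\<^esub> f) s \<cdot>\<^bsub>PObj F d\<^esub> AMap (PArr F h) (PComp F g f s)"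


section \<open>Categories with a chosen terminal object and chosen pullbacks\<close>

definition is_terminal :: "('o, 'a, 'z) cat_scheme \<Rightarrow> 'o \<Rightarrow> bool" where
  "is_terminal C T \<longleftrightarrow> T \<in> Obj C \<and> (\<forall>A \<in> Obj C. \<exists>!f. f \<in> Hom C A T)"

definition is_pullback ::
    "('o, 'a, 'z) cat_scheme \<Rightarrow> 'a \<Rightarrow> 'a \<Rightarrow> 'a \<Rightarrow> 'a \<Rightarrow> bool" where
  "is_pullback C f g p q \<longleftrightarrow>
     p \<in> Arr C \<and> q \<in> Arr C \<and> Dom C p = Dom C q \<and>
     Cod C p = Dom C f \<and> Cod C q = Dom C g \<and> f \<cdot>\<^bsub>C\<^esub> p = g \<cdot>\<^bsub>C\<^esub> q \<and>
     (\<forall>W. \<forall>u \<in> Hom C W (Dom C f). \<forall>v \<in> Hom C W (Dom C g).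
        f \<cdot>\<^bsub>C\<^esub> u = g \<cdot>\<^bsub>C\<^esub> v
        \<longrightarrow> (\<exists>!h. h \<in> Hom C W (Dom C p) \<and> p \<cdot>\<^bsub>C\<^esub> h = u \<and> q \<cdot>\<^bsub>C\<^esub> h = v))"

text \<open>
  For \<open>f : P \<rightarrow> Y\<close> and \<open>g : Z \<rightarrow> Y\<close>, \<open>Pb1 C f g : P \<times>\<^sub>Y Z \<rightarrow> P\<close> is the projection written
  \<open>f\<^sup>*g\<close>, and \<open>Pb2 C f g : P \<times>\<^sub>Y Z \<rightarrow> Z\<close> is the projection written \<open>g\<^sup>*f\<close>.
\<close>

record ('o, 'a) pbcat = "('o, 'a) cat" +
  Trm :: 'o
  Pb1 :: "'a \<Rightarrow> 'a \<Rightarrow> 'a"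
  Pb2 :: "'a \<Rightarrow> 'a \<Rightarrow> 'a"

locale category_with_pullbacks_and_terminal =
  category C for C :: "('o, 'a, 'z) pbcat_scheme" (structure) +
  assumes terminal: "is_terminal C (Trm C)"
    and pullback: "\<lbrakk>f \<in> Arr C; g \<in> Arr C; Cod C f = Cod C g\<rbrakk>
      \<Longrightarrow> is_pullback C f g (Pb1 C f g) (Pb2 C f g)"

definition pbo :: "('o, 'a, 'z) pbcat_scheme \<Rightarrow> 'a \<Rightarrow> 'a \<Rightarrow> 'o" where
  "pbo C f g = Dom C (Pb1 C f g)"

definition pb_lift :: "('o, 'a, 'z) pbcat_scheme \<Rightarrow> 'a \<Rightarrow> 'a \<Rightarrow> 'a \<Rightarrow> 'a \<Rightarrow> 'a" where
  "pb_lift C f g u v = (THE h. h \<in> Hom C (Dom C u) (pbo C f g) \<and>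
      Pb1 C f g \<cdot>\<^bsub>C\<^esub> h = u \<and> Pb2 C f g \<cdot>\<^bsub>C\<^esub> h = v)"

lemma (in category_with_pullbacks_and_terminal) pb_lift_char:
  assumes "f \<in> Arr C" "g \<in> Arr C" "Cod C f = Cod C g"
    and "u \<in> Hom C W (Dom C f)" "v \<in> Hom C W (Dom C g)" "f \<cdot> u = g \<cdot> v"
  shows "h = pb_lift C f g u v \<longleftrightarrow>
    h \<in> Hom C W (pbo C f g) \<and> Pb1 C f g \<cdot> h = u \<and> Pb2 C f g \<cdot> h = v"
proof -
  have ex1: "\<exists>!h. h \<in> Hom C W (pbo C f g) \<and> Pb1 C f g \<cdot> h = u \<and> Pb2 C f g \<cdot> h = v"
    using pullback[OF assms(1-3)] assms(4-6) unfolding is_pullback_def pbo_def by blast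
  have "Dom C u = W"
    using assms(4) by (simp add: Hom_def)
  then show ?thesis
    using theI'[OF ex1] ex1 unfolding pb_lift_def by auto
qed

text \<open>Binary products are the chosen pullbacks over the terminal object.\<close>

definition bang :: "('o, 'a, 'z) pbcat_scheme \<Rightarrow> 'o \<Rightarrow> 'a" where
  "bang C A = (THE f. f \<in> Hom C A (Trm C))"

definition prd :: "('o, 'a, 'z) pbcat_scheme \<Rightarrow> 'o \<Rightarrow> 'o \<Rightarrow> 'o" where
  "prd C A B = pbo C (bang C A) (bang C B)"

definition pr1 :: "('o, 'a, 'z) pbcat_scheme \<Rightarrow> 'o \<Rightarrow> 'o \<Rightarrow> 'a" where
  "pr1 C A B = Pb1 C (bang C A) (bang C B)"

definition pr2 :: "('o, 'a, 'z) pbcat_scheme \<Rightarrow> 'o \<Rightarrow> 'o \<Rightarrow> 'a" where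
  "pr2 C A B = Pb2 C (bang C A) (bang C B)"

definition pairing :: "('o, 'a, 'z) pbcat_scheme \<Rightarrow> 'a \<Rightarrow> 'a \<Rightarrow> 'a" where
  "pairing C u v = pb_lift C (bang C (Cod C u)) (bang C (Cod C v)) u v"

definition prod_map :: "('o, 'a, 'z) pbcat_scheme \<Rightarrow> 'a \<Rightarrow> 'a \<Rightarrow> 'a" where
  "prod_map C f g = pairing C (f \<cdot>\<^bsub>C\<^esub> pr1 C (Dom C f) (Dom C g))
                              (g \<cdot>\<^bsub>C\<^esub> pr2 C (Dom C f) (Dom C g))"

text \<open>The canonical isomorphism \<open>(A \<times> B) \<times> D \<rightarrow> A \<times> (B \<times> D)\<close>.\<close>

definition prod_assoc :: "('o, 'a, 'z) pbcat_scheme \<Rightarrow> 'o \<Rightarrow> 'o \<Rightarrow> 'o \<Rightarrow> 'a" where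
  "prod_assoc C A B D =
     pairing C (pr1 C A B \<cdot>\<^bsub>C\<^esub> pr1 C (prd C A B) D)
       (pairing C (pr2 C A B \<cdot>\<^bsub>C\<^esub> pr1 C (prd C A B) D) (pr2 C (prd C A B) D))"


section \<open>Grothendieck topologies\<close>

definition is_sieve :: "('o, 'a, 'z) cat_scheme \<Rightarrow> 'o \<Rightarrow> 'a set \<Rightarrow> bool" where
  "is_sieve C Y S \<longleftrightarrow> S \<subseteq> {f \<in> Arr C. Cod C f = Y} \<and>
     (\<forall>f \<in> S. \<forall>g \<in> Arr C. Cod C g = Dom C f \<longrightarrow> f \<cdot>\<^bsub>C\<^esub> g \<in> S)"

definition pull_sieve :: "('o, 'a, 'z) cat_scheme \<Rightarrow> 'a \<Rightarrow> 'a set \<Rightarrow> 'a set" where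
  "pull_sieve C f S = {g \<in> Arr C. Cod C g = Dom C f \<and> f \<cdot>\<^bsub>C\<^esub> g \<in> S}"

locale grothendieck_topology =
  fixes C :: "('o, 'a, 'z) cat_scheme" and \<tau> :: "'o \<Rightarrow> 'a set set"
  assumes sieves: "\<lbrakk>Y \<in> Obj C; S \<in> \<tau> Y\<rbrakk> \<Longrightarrow> is_sieve C Y S"
    and maximal: "Y \<in> Obj C \<Longrightarrow> {f \<in> Arr C. Cod C f = Y} \<in> \<tau> Y"
    and stable: "\<lbrakk>f \<in> Hom C Z Y; S \<in> \<tau> Y\<rbrakk> \<Longrightarrow> pull_sieve C f S \<in> \<tau> Z"
    and transitive: "\<lbrakk>Y \<in> Obj C; S \<in> \<tau> Y; is_sieve C Y R;
        \<And>f. f \<in> S \<Longrightarrow> pull_sieve C f R \<in> \<tau> (Dom C f)\<rbrakk> \<Longrightarrow> R \<in> \<tau> Y"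

definition generated_sieve :: "('o, 'a, 'z) cat_scheme \<Rightarrow> 'a set \<Rightarrow> 'a set" where
  "generated_sieve C U = {f \<cdot>\<^bsub>C\<^esub> g | f g. f \<in> U \<and> g \<in> Arr C \<and> Cod C g = Dom C f}"

text \<open>
  A family of arrows into \<open>Y\<close> is covering if the sieve it generates is covering. As this
  depends only on the set of members, families are represented as sets of arrows.
\<close>

definition covering_family ::
    "('o, 'a, 'z) cat_scheme \<Rightarrow> ('o \<Rightarrow> 'a set set) \<Rightarrow> 'o \<Rightarrow> 'a set \<Rightarrow> bool" where
  "covering_family C \<tau> Y U \<longleftrightarrow>
     U \<subseteq> {f \<in> Arr C. Cod C f = Y} \<and> generated_sieve C U \<in> \<tau> Y"


section \<open>Group objects and actions\<close>

definition group_object ::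
    "('o, 'a, 'z) pbcat_scheme \<Rightarrow> 'o \<Rightarrow> 'a \<Rightarrow> 'a \<Rightarrow> bool" where
  "group_object C G m e \<longleftrightarrow>
     G \<in> Obj C \<and> m \<in> Hom C (prd C G G) G \<and> e \<in> Hom C (Trm C) G \<and>
     m \<cdot>\<^bsub>C\<^esub> prod_map C (Id C G) m \<cdot>\<^bsub>C\<^esub> prod_assoc C G G G = m \<cdot>\<^bsub>C\<^esub> prod_map C m (Id C G) \<and>
     m \<cdot>\<^bsub>C\<^esub> prod_map C e (Id C G) = pr2 C (Trm C) G \<and>
     m \<cdot>\<^bsub>C\<^esub> prod_map C (Id C G) e = pr1 C G (Trm C) \<and>
     (\<exists>i \<in> Hom C G G.
        m \<cdot>\<^bsub>C\<^esub> pairing C i (Id C G) = e \<cdot>\<^bsub>C\<^esub> bang C G \<and>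
        m \<cdot>\<^bsub>C\<^esub> pairing C (Id C G) i = e \<cdot>\<^bsub>C\<^esub> bang C G)"

definition group_action ::
    "('o, 'a, 'z) pbcat_scheme \<Rightarrow> 'o \<Rightarrow> 'a \<Rightarrow> 'a \<Rightarrow> 'o \<Rightarrow> 'a \<Rightarrow> bool" where
  "group_action C G m e X x \<longleftrightarrow>
     X \<in> Obj C \<and> x \<in> Hom C (prd C G X) X \<and>
     x \<cdot>\<^bsub>C\<^esub> prod_map C (Id C G) x \<cdot>\<^bsub>C\<^esub> prod_assoc C G G X = x \<cdot>\<^bsub>C\<^esub> prod_map C m (Id C X) \<and>
     x \<cdot>\<^bsub>C\<^esub> prod_map C e (Id C X) = pr2 C (Trm C) X"

definition equivariant ::
    "('o, 'a, 'z) pbcat_scheme \<Rightarrow> 'o \<Rightarrow> 'a \<Rightarrow> 'a \<Rightarrow> 'a \<Rightarrow> bool" where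
  "equivariant C G x y f \<longleftrightarrow> f \<cdot>\<^bsub>C\<^esub> x = y \<cdot>\<^bsub>C\<^esub> prod_map C (Id C G) f"

definition trivial_action :: "('o, 'a, 'z) pbcat_scheme \<Rightarrow> 'o \<Rightarrow> 'o \<Rightarrow> 'a" where
  "trivial_action C G Y = pr2 C G Y"

definition pullback_action ::
    "('o, 'a, 'z) pbcat_scheme \<Rightarrow> 'o \<Rightarrow> 'a \<Rightarrow> 'a \<Rightarrow> 'a \<Rightarrow> 'a \<Rightarrow> 'a" where
  "pullback_action C G p z f g =
     (THE \<psi>. \<psi> \<in> Hom C (prd C G (pbo C f g)) (pbo C f g) \<and>
        Pb1 C f g \<cdot>\<^bsub>C\<^esub> \<psi> = p \<cdot>\<^bsub>C\<^esub> prod_map C (Id C G) (Pb1 C f g) \<and>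
        Pb2 C f g \<cdot>\<^bsub>C\<^esub> \<psi> = z \<cdot>\<^bsub>C\<^esub> prod_map C (Id C G) (Pb2 C f g))"

text \<open>On generalized elements: \<open>(g, (h, u)) \<mapsto> (m(g, h), u)\<close>.\<close>

definition mult_action :: "('o, 'a, 'z) pbcat_scheme \<Rightarrow> 'o \<Rightarrow> 'a \<Rightarrow> 'o \<Rightarrow> 'a" where
  "mult_action C G m U =
     pairing C
       (m \<cdot>\<^bsub>C\<^esub> pairing C (pr1 C G (prd C G U)) (pr1 C G U \<cdot>\<^bsub>C\<^esub> pr2 C G (prd C G U)))
       (pr2 C G U \<cdot>\<^bsub>C\<^esub> pr2 C G (prd C G U))"


section \<open>Principal bundles\<close>

definition locally_trivial ::
    "('o, 'a, 'z) pbcat_scheme \<Rightarrow> ('o \<Rightarrow> 'a set set) \<Rightarrow> 'o \<Rightarrow> 'a \<Rightarrow> 'o \<Rightarrow> 'a \<Rightarrow> 'a \<Rightarrow> bool" where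
  "locally_trivial C \<tau> G m Y p \<pi> \<longleftrightarrow>
     (\<exists>\<U>. covering_family C \<tau> Y \<U> \<and>
       (\<forall>f \<in> \<U>. \<exists>\<phi> \<in> Hom C (pbo C \<pi> f) (prd C G (Dom C f)).
          is_iso C \<phi> \<and>
          equivariant C G (pullback_action C G p (trivial_action C G (Dom C f)) \<pi> f)
            (mult_action C G m (Dom C f)) \<phi> \<and>
          pr2 C G (Dom C f) \<cdot>\<^bsub>C\<^esub> \<phi> = Pb2 C \<pi> f))"

definition principal_bundle ::
    "('o, 'a, 'z) pbcat_scheme \<Rightarrow> ('o \<Rightarrow> 'a set set) \<Rightarrow> 'o \<Rightarrow> 'a \<Rightarrow> 'a
      \<Rightarrow> 'o \<Rightarrow> 'o \<Rightarrow> 'a \<Rightarrow> 'a \<Rightarrow> bool" where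
  "principal_bundle C \<tau> G m e Y P p \<pi> \<longleftrightarrow>
     group_action C G m e P p \<and> \<pi> \<in> Hom C P Y \<and>
     equivariant C G p (trivial_action C G Y) \<pi> \<and>
     locally_trivial C \<tau> G m Y p \<pi>"

definition bundle_morphism ::
    "('o, 'a, 'z) pbcat_scheme \<Rightarrow> 'o
      \<Rightarrow> 'o \<Rightarrow> 'a \<Rightarrow> 'a \<Rightarrow> 'o \<Rightarrow> 'a \<Rightarrow> 'a \<Rightarrow> 'a \<Rightarrow> bool" where
  "bundle_morphism C G P p \<pi>\<^sub>P Q q \<pi>\<^sub>Q \<phi> \<longleftrightarrow>
     \<phi> \<in> Hom C P Q \<and> equivariant C G p q \<phi> \<and> \<pi>\<^sub>Q \<cdot>\<^bsub>C\<^esub> \<phi> = \<pi>\<^sub>P"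


section \<open>The quotient prestack\<close>

text \<open>An object \<open>(P, \<alpha>)\<close>, with the action and the projection of the bundle \<open>P\<close> made explicit.\<close>

record ('o, 'a) bundle_over =
  Tot :: 'o
  Act :: 'a
  Proj :: 'a
  Map :: 'a

text \<open>An arrow records its source and target, since these are not determined by \<open>\<phi>\<close>.\<close>

type_synonym ('o, 'a) bundle_arr = "('o, 'a) bundle_over \<times> 'a \<times> ('o, 'a) bundle_over"

definition qobj ::
    "('o, 'a, 'z) pbcat_scheme \<Rightarrow> ('o \<Rightarrow> 'a set set) \<Rightarrow> 'o \<Rightarrow> 'a \<Rightarrow> 'a \<Rightarrow> 'o \<Rightarrow> 'a
      \<Rightarrow> 'o \<Rightarrow> ('o, 'a) bundle_over set" where
  "qobj C \<tau> G m e X x Y =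
     {A. principal_bundle C \<tau> G m e Y (Tot A) (Act A) (Proj A) \<and>
         Map A \<in> Hom C (Tot A) X \<and> equivariant C G (Act A) x (Map A)}"

definition qarr ::
    "('o, 'a, 'z) pbcat_scheme \<Rightarrow> ('o \<Rightarrow> 'a set set) \<Rightarrow> 'o \<Rightarrow> 'a \<Rightarrow> 'a \<Rightarrow> 'o \<Rightarrow> 'a
      \<Rightarrow> 'o \<Rightarrow> ('o, 'a) bundle_arr set" where
  "qarr C \<tau> G m e X x Y =
     {(A, \<phi>, B) | A \<phi> B. A \<in> qobj C \<tau> G m e X x Y \<and> B \<in> qobj C \<tau> G m e X x Y \<and>
         bundle_morphism C G (Tot A) (Act A) (Proj A) (Tot B) (Act B) (Proj B) \<phi> \<and>
         Map B \<cdot>\<^bsub>C\<^esub> \<phi> = Map A}"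

definition qcat ::
    "('o, 'a, 'z) pbcat_scheme \<Rightarrow> ('o \<Rightarrow> 'a set set) \<Rightarrow> 'o \<Rightarrow> 'a \<Rightarrow> 'a \<Rightarrow> 'o \<Rightarrow> 'a
      \<Rightarrow> 'o \<Rightarrow> (('o, 'a) bundle_over, ('o, 'a) bundle_arr) cat" where
  "qcat C \<tau> G m e X x Y =
     \<lparr>Obj = qobj C \<tau> G m e X x Y,
      Arr = qarr C \<tau> G m e X x Y,
      Dom = (\<lambda>(A, \<phi>, B). A),
      Cod = (\<lambda>(A, \<phi>, B). B),
      Id = (\<lambda>A. (A, Id C (Tot A), A)),
      Cmp = (\<lambda>(B', \<psi>, D) (A, \<phi>, B). (A, \<psi> \<cdot>\<^bsub>C\<^esub> \<phi>, D))\<rparr>"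

definition qpull_obj ::
    "('o, 'a, 'z) pbcat_scheme \<Rightarrow> 'o \<Rightarrow> 'a \<Rightarrow> ('o, 'a) bundle_over \<Rightarrow> ('o, 'a) bundle_over" where
  "qpull_obj C G f A =
     \<lparr>Tot = pbo C (Proj A) f,
      Act = pullback_action C G (Act A) (trivial_action C G (Dom C f)) (Proj A) f,
      Proj = Pb2 C (Proj A) f,
      Map = Map A \<cdot>\<^bsub>C\<^esub> Pb1 C (Proj A) f\<rparr>"

definition qpull ::
    "('o, 'a, 'z) pbcat_scheme \<Rightarrow> 'o \<Rightarrow> 'a
      \<Rightarrow> (('o, 'a) bundle_over, ('o, 'a) bundle_arr,
          ('o, 'a) bundle_over, ('o, 'a) bundle_arr) fctr" where
  "qpull C G f =
     \<lparr>OMap = qpull_obj C G f,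
      AMap = (\<lambda>(A, \<phi>, B).
        (qpull_obj C G f A,
         pb_lift C (Proj B) f (\<phi> \<cdot>\<^bsub>C\<^esub> Pb1 C (Proj A) f) (Pb2 C (Proj A) f),
         qpull_obj C G f B))\<rparr>"

text \<open>The canonical isomorphism \<open>P \<rightarrow> P \<times>\<^sub>Y Y\<close>.\<close>

definition qunit ::
    "('o, 'a, 'z) pbcat_scheme \<Rightarrow> 'o \<Rightarrow> 'o \<Rightarrow> ('o, 'a) bundle_over \<Rightarrow> ('o, 'a) bundle_arr" where
  "qunit C G Y A =
     (A, pb_lift C (Proj A) (Id C Y) (Id C (Tot A)) (Proj A), qpull_obj C G (Id C Y) A)"

text \<open>
  The canonical isomorphism \<open>(P \<times>\<^sub>Y Z) \<times>\<^sub>Z W \<rightarrow> P \<times>\<^sub>Y W\<close> for \<open>f : Z \<rightarrow> Y\<close> and \<open>g : W \<rightarrow> Z\<close>.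
\<close>

definition qcomp ::
    "('o, 'a, 'z) pbcat_scheme \<Rightarrow> 'o \<Rightarrow> 'a \<Rightarrow> 'a
      \<Rightarrow> ('o, 'a) bundle_over \<Rightarrow> ('o, 'a) bundle_arr" where
  "qcomp C G g f A =
     (qpull_obj C G g (qpull_obj C G f A),
      pb_lift C (Proj A) (f \<cdot>\<^bsub>C\<^esub> g)
        (Pb1 C (Proj A) f \<cdot>\<^bsub>C\<^esub> Pb1 C (Pb2 C (Proj A) f) g)
        (Pb2 C (Pb2 C (Proj A) f) g),
      qpull_obj C G (f \<cdot>\<^bsub>C\<^esub> g) A)"

definition quotient_prestack ::
    "('o, 'a, 'z) pbcat_scheme \<Rightarrow> ('o \<Rightarrow> 'a set set) \<Rightarrow> 'o \<Rightarrow> 'a \<Rightarrow> 'a \<Rightarrow> 'o \<Rightarrow> 'a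
      \<Rightarrow> ('o, 'a, ('o, 'a) bundle_over, ('o, 'a) bundle_arr) pseudofun" where
  "quotient_prestack C \<tau> G m e X x =
     \<lparr>PObj = qcat C \<tau> G m e X x,
      PArr = qpull C G,
      PUnit = qunit C G,
      PComp = qcomp C G\<rparr>"

end

theory Submission
  imports Defs
begin

text \<open>
  Everything except local triviality is a statement about maps into pullbacks, and a map into a
  pullback is determined by its two projections. Pulling back is therefore functorial up to the
  comparison maps \<open>P \<rightarrow> P \<times>\<^sub>Y Y\<close> and \<open>(P \<times>\<^sub>Y Z) \<times>\<^sub>Z W \<rightarrow> P \<times>\<^sub>Y W\<close>, and these are natural and coherent
  because the two sides of each law have the same projections. The comparison maps are equivariant and
  invertible in the base category; they are then isomorphisms of the objects \<open>(P, \<alpha>)\<close>, because the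
  inverse of an equivariant map is again equivariant (\<open>Q_isoI\<close>).

  The point that needs the topology is that \<open>P \<times>\<^sub>Y Z \<rightarrow> Z\<close> is again locally trivial, so that
  pulling back along \<open>f : Z \<rightarrow> Y\<close> lands in the right category. Let \<open>(u : U \<rightarrow> Y)\<close> be a covering
  family over which \<open>P\<close> is trivial. The projections \<open>Z \<times>\<^sub>Y U \<rightarrow> Z\<close> form a covering family, since the
  sieve they generate is exactly the pullback along \<open>f\<close> of the sieve generated by the maps \<open>u\<close>
  (\<open>covering_family_pullback\<close>). A trivialization along \<open>u\<close> gives one along every composite \<open>u \<cdot> k\<close>,
  by transporting the \<open>G\<close>-coordinate (\<open>trivial_along_comp\<close>); with \<open>k\<close> the projection
  \<open>Z \<times>\<^sub>Y U \<rightarrow> U\<close>, the composite \<open>u \<cdot> k\<close> is also \<open>f\<close> after \<open>Z \<times>\<^sub>Y U \<rightarrow> Z\<close>, and the comparison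
  isomorphism for iterated pullbacks turns a trivialization of \<open>P\<close> along \<open>f \<cdot> g\<close> into one of
  \<open>P \<times>\<^sub>Y Z\<close> along \<open>g\<close> (\<open>trivial_along_pullback\<close>).

  All equations between maps out of products \<open>G \<times> P\<close> are stated for generalized elements, that is,
  after composition with an arbitrary pair \<open>(a, u)\<close>. Associativity and equivariance then read as in
  ordinary algebra, without associators or product maps, and rewriting proves them.
\<close>


section \<open>Categories and functors\<close>

context category
begin

lemma Hom_iff: "f \<in> Hom C A B \<longleftrightarrow> f \<in> Arr C \<and> Dom C f = A \<and> Cod C f = B"
  by (simp add: Hom_def)

lemma dom_obj [simp]: "f \<in> Arr C \<Longrightarrow> Dom C f \<in> Obj C"
  and cod_obj [simp]: "f \<in> Arr C \<Longrightarrow> Cod C f \<in> Obj C"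
  by (simp_all add: dom_in cod_in)

lemma id_arr [simp]:
  assumes "A \<in> Obj C"
  shows "Id C A \<in> Arr C" "Dom C (Id C A) = A" "Cod C (Id C A) = A"
  using id_in[OF assms] by (simp_all add: Hom_iff)

lemma comp_arr [simp]:
  assumes "f \<in> Arr C" "g \<in> Arr C" "Cod C f = Dom C g"
  shows "g \<cdot> f \<in> Arr C" "Dom C (g \<cdot> f) = Dom C f" "Cod C (g \<cdot> f) = Cod C g"
  using comp_in[of f "Dom C f" "Dom C g" g "Cod C g"] assms by (simp_all add: Hom_iff)

lemma comp_id [simp]: "f \<in> Arr C \<Longrightarrow> Dom C f = A \<Longrightarrow> f \<cdot> Id C A = f"
  and id_comp [simp]: "f \<in> Arr C \<Longrightarrow> Cod C f = A \<Longrightarrow> Id C A \<cdot> f = f"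
  using id_right[of f A "Cod C f"] id_left[of f "Dom C f" A] by (simp_all add: Hom_iff)

lemma comp_assoc [simp]:
  assumes "f \<in> Arr C" "g \<in> Arr C" "h \<in> Arr C" "Cod C f = Dom C g" "Cod C g = Dom C h"
  shows "(h \<cdot> g) \<cdot> f = h \<cdot> (g \<cdot> f)"
  using assoc[of f "Dom C f" "Dom C g" g "Dom C h" h "Cod C h"] assms by (simp add: Hom_iff)

text \<open>
  As composites are normalised to the right, an equation between composites rewrites inside a longer
  composite only in this form.
\<close>

lemma comp_eq_extend:
  assumes "h \<cdot> g = k" "w \<in> Arr C" "g \<in> Arr C" "h \<in> Arr C" "Cod C w = Dom C g" "Cod C g = Dom C h"
  shows "h \<cdot> (g \<cdot> w) = k \<cdot> w"
  using assms comp_assoc by metis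

lemma square_extend:
  assumes "f \<cdot> u = g \<cdot> v" "w \<in> Arr C" "f \<in> Arr C" "u \<in> Arr C" "g \<in> Arr C" "v \<in> Arr C"
    "Cod C w = Dom C u" "Cod C w = Dom C v" "Cod C u = Dom C f" "Cod C v = Dom C g"
  shows "f \<cdot> (u \<cdot> w) = g \<cdot> (v \<cdot> w)"
  using assms comp_assoc by metis

lemma is_isoI:
  assumes "f \<in> Arr C" "g \<in> Arr C" "Dom C g = Cod C f" "Cod C g = Dom C f"
    "g \<cdot> f = Id C (Dom C f)" "f \<cdot> g = Id C (Cod C f)"
  shows "is_iso C f"
  using assms unfolding is_iso_def by (intro conjI bexI[of _ g]) (simp_all add: Hom_iff)

end

lemma functor_comp:
  assumes "is_functor A B F" "is_functor B D K"
  shows "is_functor A D (comp_functor K F)"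
proof -
  interpret F: is_functor A B F by fact
  interpret K: is_functor B D K by fact
  show ?thesis
  proof
    show "OMap (comp_functor K F) a \<in> Obj D" if "a \<in> Obj A" for a
      using that by (simp add: comp_functor_def F.obj_map K.obj_map)
    show "AMap (comp_functor K F) f \<in> Hom D (OMap (comp_functor K F) a) (OMap (comp_functor K F) b)"
      if "f \<in> Hom A a b" for f a b
      using that by (simp add: comp_functor_def F.arr_map K.arr_map)
    show "AMap (comp_functor K F) (Id A a) = Id D (OMap (comp_functor K F) a)" if "a \<in> Obj A" for a
      using that by (simp add: comp_functor_def F.id_map F.obj_map K.id_map)
    show "AMap (comp_functor K F) (g \<cdot>\<^bsub>A\<^esub> f) = AMap (comp_functor K F) g \<cdot>\<^bsub>D\<^esub> AMap (comp_functor K F) f"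
      if "f \<in> Hom A a b" "g \<in> Hom A b c" for f g a b c
      using K.comp_map[OF F.arr_map[OF that(1)] F.arr_map[OF that(2)]] F.comp_map[OF that]
      by (simp add: comp_functor_def)
  qed
qed

lemma functor_id:
  assumes "category A"
  shows "is_functor A A id_functor"
proof -
  interpret category A by fact
  show ?thesis by unfold_locales (simp_all add: id_functor_def id_in)
qed


section \<open>Finite limits through generalized elements\<close>

context category_with_pullbacks_and_terminal
begin

lemma proj_arr [simp]:
  assumes "f \<in> Arr C" "g \<in> Arr C" "Cod C f = Cod C g"
  shows "Pb1 C f g \<in> Arr C" "Dom C (Pb1 C f g) = pbo C f g" "Cod C (Pb1 C f g) = Dom C f"
    "Pb2 C f g \<in> Arr C" "Dom C (Pb2 C f g) = pbo C f g" "Cod C (Pb2 C f g) = Dom C g"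
    "pbo C f g \<in> Obj C"
  using pullback[OF assms] dom_in[of "Pb1 C f g"] unfolding is_pullback_def pbo_def by auto

lemma pb_square [simp]:
  assumes "f \<in> Arr C" "g \<in> Arr C" "Cod C f = Cod C g"
  shows "f \<cdot> Pb1 C f g = g \<cdot> Pb2 C f g"
  using pullback[OF assms] unfolding is_pullback_def by auto

lemma pb_square_extend [simp]:
  assumes "f \<in> Arr C" "g \<in> Arr C" "Cod C f = Cod C g" "h \<in> Arr C" "Cod C h = pbo C f g"
  shows "f \<cdot> (Pb1 C f g \<cdot> h) = g \<cdot> (Pb2 C f g \<cdot> h)"
  by (rule square_extend) (use assms in auto)

lemma pb_lift_arr [simp]:
  assumes "f \<in> Arr C" "g \<in> Arr C" "Cod C f = Cod C g" "u \<in> Arr C" "v \<in> Arr C"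
    "Cod C u = Dom C f" "Cod C v = Dom C g" "Dom C u = Dom C v" "f \<cdot> u = g \<cdot> v"
  shows "pb_lift C f g u v \<in> Arr C" "Dom C (pb_lift C f g u v) = Dom C v"
    "Cod C (pb_lift C f g u v) = pbo C f g"
    "Pb1 C f g \<cdot> pb_lift C f g u v = u" "Pb2 C f g \<cdot> pb_lift C f g u v = v"
  using pb_lift_char[of f g u "Dom C v" v "pb_lift C f g u v"] assms by (auto simp: Hom_iff)

lemma pb_eqI:
  assumes "f \<in> Arr C" "g \<in> Arr C" "Cod C f = Cod C g" "h \<in> Arr C" "k \<in> Arr C"
    "Dom C h = Dom C k" "Cod C h = pbo C f g" "Cod C k = pbo C f g"
    and 1: "Pb1 C f g \<cdot> h = Pb1 C f g \<cdot> k" and 2: "Pb2 C f g \<cdot> h = Pb2 C f g \<cdot> k"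
  shows "h = k"
proof -
  have "h = pb_lift C f g (Pb1 C f g \<cdot> k) (Pb2 C f g \<cdot> k)"
    using assms by (subst pb_lift_char[where W = "Dom C k"]) (auto simp: Hom_iff)
  moreover have "k = pb_lift C f g (Pb1 C f g \<cdot> k) (Pb2 C f g \<cdot> k)"
    using assms by (subst pb_lift_char[where W = "Dom C k"]) (auto simp: Hom_iff)
  ultimately show ?thesis by simp
qed

lemma pb_lift_comp [simp]:
  assumes "f \<in> Arr C" "g \<in> Arr C" "Cod C f = Cod C g" "u \<in> Arr C" "v \<in> Arr C"
    "Cod C u = Dom C f" "Cod C v = Dom C g" "Dom C u = Dom C v" "f \<cdot> u = g \<cdot> v"
    "w \<in> Arr C" "Cod C w = Dom C v"
  shows "pb_lift C f g u v \<cdot> w = pb_lift C f g (u \<cdot> w) (v \<cdot> w)"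
proof -
  have sq: "f \<cdot> (u \<cdot> w) = g \<cdot> (v \<cdot> w)"
    by (rule square_extend) (use assms in auto)
  show ?thesis
  proof (rule pb_eqI[of f g])
    show "Pb1 C f g \<cdot> pb_lift C f g u v \<cdot> w = Pb1 C f g \<cdot> pb_lift C f g (u \<cdot> w) (v \<cdot> w)"
      using assms sq comp_eq_extend[of "Pb1 C f g" "pb_lift C f g u v" u w] by simp
    show "Pb2 C f g \<cdot> pb_lift C f g u v \<cdot> w = Pb2 C f g \<cdot> pb_lift C f g (u \<cdot> w) (v \<cdot> w)"
      using assms sq comp_eq_extend[of "Pb2 C f g" "pb_lift C f g u v" v w] by simp
  qed (use assms sq in simp_all)
qed

lemma trm_obj [simp]: "Trm C \<in> Obj C"
  using terminal by (simp add: is_terminal_def)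

lemma bang_arr [simp]:
  assumes "A \<in> Obj C"
  shows "bang C A \<in> Arr C" "Dom C (bang C A) = A" "Cod C (bang C A) = Trm C"
proof -
  have "\<exists>!f. f \<in> Hom C A (Trm C)"
    using terminal assms by (simp add: is_terminal_def)
  from theI'[OF this] show "bang C A \<in> Arr C" "Dom C (bang C A) = A" "Cod C (bang C A) = Trm C"
    by (simp_all add: bang_def Hom_iff)
qed

lemma bang_unique:
  assumes "f \<in> Arr C" "Cod C f = Trm C"
  shows "f = bang C (Dom C f)"
proof -
  have "\<exists>!h. h \<in> Hom C (Dom C f) (Trm C)"
    using terminal assms by (simp add: is_terminal_def)
  then show ?thesis
    using assms bang_arr[of "Dom C f"] by (auto simp: Hom_iff)
qed

lemma bang_comp [simp]:
  assumes "f \<in> Arr C" "Cod C f = A"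
  shows "bang C A \<cdot> f = bang C (Dom C f)"
proof -
  have "A \<in> Obj C" using assms by auto
  then show ?thesis
    using assms bang_unique[of "bang C A \<cdot> f"] by simp
qed

lemma prd_arr [simp]:
  assumes "A \<in> Obj C" "B \<in> Obj C"
  shows "pr1 C A B \<in> Arr C" "Dom C (pr1 C A B) = prd C A B" "Cod C (pr1 C A B) = A"
    "pr2 C A B \<in> Arr C" "Dom C (pr2 C A B) = prd C A B" "Cod C (pr2 C A B) = B"
    "prd C A B \<in> Obj C"
  using assms by (simp_all add: pr1_def pr2_def prd_def)

lemma pairing_arr [simp]:
  assumes "u \<in> Arr C" "v \<in> Arr C" "Dom C u = Dom C v"
  shows "pairing C u v \<in> Arr C" "Dom C (pairing C u v) = Dom C v"
    "Cod C (pairing C u v) = prd C (Cod C u) (Cod C v)"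
  using assms by (simp_all add: pairing_def prd_def)

lemma pr_pairing [simp]:
  assumes "u \<in> Arr C" "v \<in> Arr C" "Dom C u = Dom C v" "Cod C u = A" "Cod C v = B"
  shows "pr1 C A B \<cdot> pairing C u v = u" "pr2 C A B \<cdot> pairing C u v = v"
proof -
  have "A \<in> Obj C" "B \<in> Obj C" using assms by auto
  then show "pr1 C A B \<cdot> pairing C u v = u" "pr2 C A B \<cdot> pairing C u v = v"
    using assms by (simp_all add: pairing_def prd_def pr1_def pr2_def)
qed

lemma pairing_comp [simp]:
  assumes "u \<in> Arr C" "v \<in> Arr C" "Dom C u = Dom C v" "w \<in> Arr C" "Cod C w = Dom C v"
  shows "pairing C u v \<cdot> w = pairing C (u \<cdot> w) (v \<cdot> w)"
  using assms by (simp add: pairing_def)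

lemma prd_eqI:
  assumes "A \<in> Obj C" "B \<in> Obj C" "h \<in> Arr C" "k \<in> Arr C"
    "Dom C h = Dom C k" "Cod C h = prd C A B" "Cod C k = prd C A B"
    "pr1 C A B \<cdot> h = pr1 C A B \<cdot> k" "pr2 C A B \<cdot> h = pr2 C A B \<cdot> k"
  shows "h = k"
  by (rule pb_eqI[of "bang C A" "bang C B"]) (use assms in \<open>simp_all add: pr1_def pr2_def prd_def\<close>)

lemma pairing_pr [simp]:
  assumes "A \<in> Obj C" "B \<in> Obj C"
  shows "pairing C (pr1 C A B) (pr2 C A B) = Id C (prd C A B)"
  by (rule prd_eqI[of A B]) (use assms in simp_all)

lemma pairing_eta:
  assumes "A \<in> Obj C" "B \<in> Obj C" "h \<in> Arr C" "Cod C h = prd C A B"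
  shows "pairing C (pr1 C A B \<cdot> h) (pr2 C A B \<cdot> h) = h"
  by (rule prd_eqI[of A B]) (use assms in simp_all)

lemma prod_map_arr [simp]:
  assumes "f \<in> Arr C" "g \<in> Arr C"
  shows "prod_map C f g \<in> Arr C" "Dom C (prod_map C f g) = prd C (Dom C f) (Dom C g)"
    "Cod C (prod_map C f g) = prd C (Cod C f) (Cod C g)"
  using assms by (simp_all add: prod_map_def)

lemma prod_map_pairing [simp]:
  assumes "f \<in> Arr C" "g \<in> Arr C" "u \<in> Arr C" "v \<in> Arr C" "Dom C u = Dom C v"
    "Cod C u = Dom C f" "Cod C v = Dom C g"
  shows "prod_map C f g \<cdot> pairing C u v = pairing C (f \<cdot> u) (g \<cdot> v)"
  using assms by (simp add: prod_map_def)

lemma prod_assoc_pairing: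
  assumes "a \<in> Arr C" "b \<in> Arr C" "u \<in> Arr C" "Dom C a = Dom C u" "Dom C b = Dom C u"
    "Cod C a = A" "Cod C b = B" "Cod C u = D"
  shows "prod_assoc C A B D \<cdot> pairing C (pairing C a b) u = pairing C a (pairing C b u)"
proof -
  have "A \<in> Obj C" "B \<in> Obj C" "D \<in> Obj C" using assms by auto
  then show ?thesis
    using assms by (simp add: prod_assoc_def)
qed

lemma prod_assoc_arr [simp]:
  assumes "A \<in> Obj C" "B \<in> Obj C" "D \<in> Obj C"
  shows "prod_assoc C A B D \<in> Arr C" "Dom C (prod_assoc C A B D) = prd C (prd C A B) D"
    "Cod C (prod_assoc C A B D) = prd C A (prd C B D)"
  using assms by (simp_all add: prod_assoc_def)

text \<open>
  The generic pair \<open>(pr1, pr2)\<close> is the identity of the product, so testing on pairs suffices.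
\<close>

lemma arr_eq_pairingI:
  assumes "A \<in> Obj C" "B \<in> Obj C" "f \<in> Arr C" "g \<in> Arr C" "Dom C f = prd C A B" "Dom C g = prd C A B"
    and "\<And>a b. \<lbrakk>a \<in> Arr C; b \<in> Arr C; Dom C a = Dom C b; Cod C a = A; Cod C b = B\<rbrakk>
      \<Longrightarrow> f \<cdot> pairing C a b = g \<cdot> pairing C a b"
  shows "f = g"
  using assms(7)[of "pr1 C A B" "pr2 C A B"] assms(1-6) by simp

end


section \<open>Actions through generalized elements\<close>

locale group_setting = category_with_pullbacks_and_terminal C
  for C :: "('o, 'a, 'z) pbcat_scheme" (structure) +
  fixes G :: 'o and m e :: 'a
  assumes group_object: "group_object C G m e"
begin

lemma group_arr [simp]:
  "G \<in> Obj C" "m \<in> Arr C" "Dom C m = prd C G G" "Cod C m = G"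
  "e \<in> Arr C" "Dom C e = Trm C" "Cod C e = G"
  using group_object by (auto simp: group_object_def Hom_iff)

abbreviation element_pair :: "'a \<Rightarrow> 'a \<Rightarrow> 'o \<Rightarrow> bool" where
  "element_pair a u A \<equiv> a \<in> Arr C \<and> u \<in> Arr C \<and> Dom C a = Dom C u \<and> Cod C a = G \<and> Cod C u = A"

text \<open>
  Equivariance and the action laws are equations between maps out of \<open>G \<times> A\<close> and
  \<open>(G \<times> G) \<times> A\<close>; evaluated on pairs, they become the familiar formulas \<open>f (a u) = a (f u)\<close>,
  \<open>a (b u) = (a b) u\<close> and \<open>e u = u\<close>.
\<close>

lemma equivariant_iff:
  assumes "x \<in> Arr C" "Dom C x = prd C G A" "Cod C x = A" "y \<in> Arr C" "Dom C y = prd C G B"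
    "f \<in> Arr C" "Dom C f = A" "Cod C f = B"
  shows "equivariant C G x y f \<longleftrightarrow>
    (\<forall>a u. element_pair a u A \<longrightarrow> f \<cdot> (x \<cdot> pairing C a u) = y \<cdot> pairing C a (f \<cdot> u))"
    (is "_ = ?R")
proof
  have [simp]: "A \<in> Obj C" "B \<in> Obj C" using assms by auto
  show ?R if eq: "equivariant C G x y f"
  proof (intro allI impI)
    fix a u assume *: "element_pair a u A"
    have "(f \<cdot> x) \<cdot> pairing C a u = (y \<cdot> prod_map C (Id C G) f) \<cdot> pairing C a u"
      using eq by (simp add: equivariant_def)
    then show "f \<cdot> (x \<cdot> pairing C a u) = y \<cdot> pairing C a (f \<cdot> u)"
      using assms * by simp
  qed
  assume R: ?R
  show "equivariant C G x y f"
    unfolding equivariant_def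
    by (rule arr_eq_pairingI[of G A]) (use assms R in simp_all)
qed

lemma group_action_iff:
  "group_action C G m e A x \<longleftrightarrow>
    A \<in> Obj C \<and> x \<in> Arr C \<and> Dom C x = prd C G A \<and> Cod C x = A \<and>
    (\<forall>a b u. element_pair a u A \<and> element_pair b u A \<longrightarrow>
      x \<cdot> pairing C a (x \<cdot> pairing C b u) = x \<cdot> pairing C (m \<cdot> pairing C a b) u) \<and>
    (\<forall>u. u \<in> Arr C \<and> Cod C u = A \<longrightarrow> x \<cdot> pairing C (e \<cdot> bang C (Dom C u)) u = u)"
    (is "?L \<longleftrightarrow> ?R")
proof -
  consider (wt) "A \<in> Obj C \<and> x \<in> Arr C \<and> Dom C x = prd C G A \<and> Cod C x = A" | (ill) "\<not> ?L" "\<not> ?R"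
    by (auto simp: group_action_def Hom_iff)
  then show ?thesis
  proof cases
    case wt
    then have [simp]: "A \<in> Obj C" "x \<in> Arr C" "Dom C x = prd C G A" "Cod C x = A" by auto
    show ?thesis
    proof
      assume L: ?L
      have ass: "x \<cdot> pairing C a (x \<cdot> pairing C b u) = x \<cdot> pairing C (m \<cdot> pairing C a b) u"
        if "element_pair a u A" "element_pair b u A" for a b u
      proof -
        have "(x \<cdot> prod_map C (Id C G) x \<cdot> prod_assoc C G G A) \<cdot> pairing C (pairing C a b) u
          = (x \<cdot> prod_map C m (Id C A)) \<cdot> pairing C (pairing C a b) u"
          using L by (simp add: group_action_def)
        then show ?thesis using that by (simp add: prod_assoc_pairing)
      qed
      have uni: "x \<cdot> pairing C (e \<cdot> bang C (Dom C u)) u = u" if "u \<in> Arr C" "Cod C u = A" for u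
      proof -
        have "(x \<cdot> prod_map C e (Id C A)) \<cdot> pairing C (bang C (Dom C u)) u
          = pr2 C (Trm C) A \<cdot> pairing C (bang C (Dom C u)) u"
          using L by (simp add: group_action_def)
        then show ?thesis using that by simp
      qed
      show ?R using wt by (intro conjI allI impI ass uni) auto
    next
      assume R: ?R
      from R have M: "\<forall>a b u. element_pair a u A \<and> element_pair b u A \<longrightarrow>
          x \<cdot> pairing C a (x \<cdot> pairing C b u) = x \<cdot> pairing C (m \<cdot> pairing C a b) u"
        and U: "\<forall>u. u \<in> Arr C \<and> Cod C u = A \<longrightarrow> x \<cdot> pairing C (e \<cdot> bang C (Dom C u)) u = u"
        by - (elim conjE, assumption)+
      have ass: "x \<cdot> prod_map C (Id C G) x \<cdot> prod_assoc C G G A = x \<cdot> prod_map C m (Id C A)"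
      proof (rule arr_eq_pairingI[of "prd C G G" A])
        fix c u assume *: "c \<in> Arr C" "u \<in> Arr C" "Dom C c = Dom C u" "Cod C c = prd C G G" "Cod C u = A"
        define a b where "a = pr1 C G G \<cdot> c" and "b = pr2 C G G \<cdot> c"
        have c: "c = pairing C a b" and ab: "element_pair a u A" "element_pair b u A"
          using * by (simp_all add: a_def b_def pairing_eta)
        have "x \<cdot> pairing C a (x \<cdot> pairing C b u) = x \<cdot> pairing C (m \<cdot> pairing C a b) u"
          using M[rule_format, OF conjI[OF ab]] .
        then show "(x \<cdot> prod_map C (Id C G) x \<cdot> prod_assoc C G G A) \<cdot> pairing C c u
          = (x \<cdot> prod_map C m (Id C A)) \<cdot> pairing C c u"
          using ab by (simp add: c prod_assoc_pairing)
      qed simp_all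
      have uni: "x \<cdot> prod_map C e (Id C A) = pr2 C (Trm C) A"
      proof (rule arr_eq_pairingI[of "Trm C" A])
        fix c u assume *: "c \<in> Arr C" "u \<in> Arr C" "Dom C c = Dom C u" "Cod C c = Trm C" "Cod C u = A"
        have "c = bang C (Dom C u)" using bang_unique[of c] * by simp
        then show "(x \<cdot> prod_map C e (Id C A)) \<cdot> pairing C c u = pr2 C (Trm C) A \<cdot> pairing C c u"
          using * U by simp
      qed simp_all
      show ?L using wt ass uni by (simp add: group_action_def Hom_iff)
    qed
  qed blast
qed

text \<open>
  The two components prescribed for the action on \<open>P \<times>\<^sub>Y Z\<close> agree over \<open>Y\<close> exactly because \<open>f\<close> is
  invariant; this is what makes the definite description meaningful.
\<close>

lemma pullback_action_characterization:
  assumes "p \<in> Arr C" "Dom C p = prd C G (Dom C f)" "Cod C p = Dom C f"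
    "f \<in> Arr C" "g \<in> Arr C" "Cod C f = Cod C g"
    and eqv: "\<And>a u. element_pair a u (Dom C f) \<Longrightarrow> f \<cdot> (p \<cdot> pairing C a u) = f \<cdot> u"
  defines "\<psi> \<equiv> pullback_action C G p (trivial_action C G (Dom C g)) f g"
  shows "\<psi> \<in> Arr C" "Dom C \<psi> = prd C G (pbo C f g)" "Cod C \<psi> = pbo C f g"
    "\<And>a u. element_pair a u (pbo C f g) \<Longrightarrow>
      Pb1 C f g \<cdot> (\<psi> \<cdot> pairing C a u) = p \<cdot> pairing C a (Pb1 C f g \<cdot> u)"
    "\<And>a u. element_pair a u (pbo C f g) \<Longrightarrow> Pb2 C f g \<cdot> (\<psi> \<cdot> pairing C a u) = Pb2 C f g \<cdot> u"
proof -
  note [simp] = assms(1-6)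
  let ?P = "\<lambda>\<psi>. \<psi> \<in> Hom C (prd C G (pbo C f g)) (pbo C f g) \<and>
        Pb1 C f g \<cdot> \<psi> = p \<cdot> prod_map C (Id C G) (Pb1 C f g) \<and>
        Pb2 C f g \<cdot> \<psi> = pr2 C G (Dom C g) \<cdot> prod_map C (Id C G) (Pb2 C f g)"
  have *: "f \<cdot> p \<cdot> prod_map C (Id C G) (Pb1 C f g)
    = g \<cdot> pr2 C G (Dom C g) \<cdot> prod_map C (Id C G) (Pb2 C f g)"
  proof (rule arr_eq_pairingI[of G "pbo C f g"])
    fix a u assume "a \<in> Arr C" "u \<in> Arr C" "Dom C a = Dom C u" "Cod C a = G" "Cod C u = pbo C f g"
    then show "(f \<cdot> p \<cdot> prod_map C (Id C G) (Pb1 C f g)) \<cdot> pairing C a u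
      = (g \<cdot> pr2 C G (Dom C g) \<cdot> prod_map C (Id C G) (Pb2 C f g)) \<cdot> pairing C a u"
      by (simp add: eqv)
  qed simp_all
  have "?P \<psi>'\<longleftrightarrow> \<psi>' = pb_lift C f g (p \<cdot> prod_map C (Id C G) (Pb1 C f g))
      (pr2 C G (Dom C g) \<cdot> prod_map C (Id C G) (Pb2 C f g))" for \<psi>'
    by (rule pb_lift_char[symmetric]) (simp_all add: * Hom_iff)
  then have "\<exists>!\<psi>. ?P \<psi>" by metis
  from theI'[OF this] have P: "?P \<psi>"
    unfolding \<psi>_def pullback_action_def trivial_action_def .
  then show [simp]: "\<psi> \<in> Arr C" "Dom C \<psi> = prd C G (pbo C f g)" "Cod C \<psi> = pbo C f g"
    by (simp_all add: Hom_iff)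
  show "Pb1 C f g \<cdot> (\<psi> \<cdot> pairing C a u) = p \<cdot> pairing C a (Pb1 C f g \<cdot> u)"
    if "element_pair a u (pbo C f g)" for a u
    using that comp_eq_extend[of "Pb1 C f g" \<psi> _ "pairing C a u"] P by simp
  show "Pb2 C f g \<cdot> (\<psi> \<cdot> pairing C a u) = Pb2 C f g \<cdot> u"
    if "element_pair a u (pbo C f g)" for a u
    using that comp_eq_extend[of "Pb2 C f g" \<psi> _ "pairing C a u"] P by simp
qed

lemma mult_action_arr [simp]:
  assumes "U \<in> Obj C"
  shows "mult_action C G m U \<in> Arr C" "Dom C (mult_action C G m U) = prd C G (prd C G U)"
    "Cod C (mult_action C G m U) = prd C G U"
  using assms by (simp_all add: mult_action_def)

lemma mult_action_pairing:
  assumes "U \<in> Obj C" "element_pair a v (prd C G U)"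
  shows "mult_action C G m U \<cdot> pairing C a v
    = pairing C (m \<cdot> pairing C a (pr1 C G U \<cdot> v)) (pr2 C G U \<cdot> v)"
  using assms by (simp add: mult_action_def)


section \<open>Actions over a base and their pullbacks\<close>


text \<open>
  A \<open>G\<close>-object with an invariant map to a base: a principal bundle without local triviality. Total
  space and base are the domain and codomain of \<open>\<pi>\<close>.
\<close>

definition G_space_over :: "'a \<Rightarrow> 'a \<Rightarrow> bool" where
  "G_space_over p \<pi> \<longleftrightarrow> \<pi> \<in> Arr C \<and> group_action C G m e (Dom C \<pi>) p \<and>
     (\<forall>a u. element_pair a u (Dom C \<pi>) \<longrightarrow> \<pi> \<cdot> (p \<cdot> pairing C a u) = \<pi> \<cdot> u)"

abbreviation pulled_action :: "'a \<Rightarrow> 'a \<Rightarrow> 'a \<Rightarrow> 'a" where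
  "pulled_action p \<pi> f \<equiv> pullback_action C G p (trivial_action C G (Dom C f)) \<pi> f"

lemma G_space_over_props:
  assumes "G_space_over p \<pi>"
  shows "\<pi> \<in> Arr C" "p \<in> Arr C" "Dom C p = prd C G (Dom C \<pi>)" "Cod C p = Dom C \<pi>"
  using assms by (simp_all add: G_space_over_def group_action_iff)

lemma G_space_over_invariant:
  assumes "G_space_over p \<pi>" "element_pair a u (Dom C \<pi>)"
  shows "\<pi> \<cdot> (p \<cdot> pairing C a u) = \<pi> \<cdot> u"
  using assms by (simp add: G_space_over_def)

lemma G_space_over_action:
  assumes "G_space_over p \<pi>"
  shows "\<lbrakk>element_pair a u (Dom C \<pi>); element_pair b u (Dom C \<pi>)\<rbrakk> \<Longrightarrow>
      p \<cdot> pairing C a (p \<cdot> pairing C b u) = p \<cdot> pairing C (m \<cdot> pairing C a b) u"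
    "\<lbrakk>u \<in> Arr C; Cod C u = Dom C \<pi>\<rbrakk> \<Longrightarrow> p \<cdot> pairing C (e \<cdot> bang C (Dom C u)) u = u"
  using assms unfolding G_space_over_def group_action_iff by simp_all

lemma G_space_over_iff:
  "group_action C G m e P p \<and> \<pi> \<in> Hom C P Y \<and> equivariant C G p (trivial_action C G Y) \<pi>
    \<longleftrightarrow> G_space_over p \<pi> \<and> Dom C \<pi> = P \<and> Cod C \<pi> = Y"
proof -
  have "equivariant C G p (trivial_action C G Y) \<pi> \<longleftrightarrow>
      (\<forall>a u. element_pair a u P \<longrightarrow> \<pi> \<cdot> (p \<cdot> pairing C a u) = \<pi> \<cdot> u)"
    if "group_action C G m e P p" "\<pi> \<in> Arr C" "Dom C \<pi> = P" "Cod C \<pi> = Y"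
  proof -
    have "P \<in> Obj C" "Y \<in> Obj C" "p \<in> Arr C" "Dom C p = prd C G P" "Cod C p = P"
      using that by (auto simp: group_action_iff)
    then show ?thesis
      using that unfolding trivial_action_def
      by (subst equivariant_iff[where A = P and B = Y]) (simp_all cong: imp_cong)
  qed
  then show ?thesis
    unfolding G_space_over_def Hom_iff by blast
qed

lemma pulled_action_props:
  assumes "G_space_over p \<pi>" "f \<in> Arr C" "Cod C f = Cod C \<pi>"
  shows "pulled_action p \<pi> f \<in> Arr C" "Dom C (pulled_action p \<pi> f) = prd C G (pbo C \<pi> f)"
    "Cod C (pulled_action p \<pi> f) = pbo C \<pi> f"
    "\<And>a u. element_pair a u (pbo C \<pi> f) \<Longrightarrow>
      Pb1 C \<pi> f \<cdot> (pulled_action p \<pi> f \<cdot> pairing C a u) = p \<cdot> pairing C a (Pb1 C \<pi> f \<cdot> u)"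
    "\<And>a u. element_pair a u (pbo C \<pi> f) \<Longrightarrow>
      Pb2 C \<pi> f \<cdot> (pulled_action p \<pi> f \<cdot> pairing C a u) = Pb2 C \<pi> f \<cdot> u"
  using pullback_action_characterization[of p \<pi> f] G_space_over_props[OF assms(1)]
    G_space_over_invariant[OF assms(1)] assms(2,3) by simp_all

lemma G_space_over_pullback:
  assumes "G_space_over p \<pi>" "f \<in> Arr C" "Cod C f = Cod C \<pi>"
  shows "G_space_over (pulled_action p \<pi> f) (Pb2 C \<pi> f)"
proof -
  note [simp] = G_space_over_props[OF assms(1)] pulled_action_props[OF assms] assms(2,3)
  let ?\<psi> = "pulled_action p \<pi> f"
  have "?\<psi> \<cdot> pairing C a (?\<psi> \<cdot> pairing C b u) = ?\<psi> \<cdot> pairing C (m \<cdot> pairing C a b) u"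
    if "element_pair a u (pbo C \<pi> f)" "element_pair b u (pbo C \<pi> f)" for a b u
    by (rule pb_eqI[of \<pi> f]) (use that in \<open>simp_all add: G_space_over_action[OF assms(1)]\<close>)
  moreover have "?\<psi> \<cdot> pairing C (e \<cdot> bang C (Dom C u)) u = u"
    if "u \<in> Arr C" "Cod C u = pbo C \<pi> f" for u
    by (rule pb_eqI[of \<pi> f])
      (use that G_space_over_action(2)[OF assms(1), of "Pb1 C \<pi> f \<cdot> u"] in simp_all)
  ultimately show ?thesis
    unfolding G_space_over_def group_action_iff by simp
qed

definition trivial_along :: "'a \<Rightarrow> 'a \<Rightarrow> 'a \<Rightarrow> bool" where
  "trivial_along p \<pi> f \<longleftrightarrow> (\<exists>\<phi> \<in> Hom C (pbo C \<pi> f) (prd C G (Dom C f)).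
     is_iso C \<phi> \<and> equivariant C G (pulled_action p \<pi> f) (mult_action C G m (Dom C f)) \<phi> \<and>
     pr2 C G (Dom C f) \<cdot> \<phi> = Pb2 C \<pi> f)"

lemma locally_trivial_iff:
  "locally_trivial C \<tau> G m Y p \<pi> \<longleftrightarrow>
    (\<exists>\<U>. covering_family C \<tau> Y \<U> \<and> (\<forall>f \<in> \<U>. trivial_along p \<pi> f))"
  by (simp add: locally_trivial_def trivial_along_def)

text \<open>
  A map to \<open>G \<times> U\<close> over \<open>U\<close> is equivariant as soon as its \<open>G\<close>-coordinate is, since the other
  coordinate is the invariant projection of the pullback. Trivializations are therefore handled through
  their \<open>G\<close>-coordinate.
\<close>

lemma equivariant_into_product_iff:
  assumes sp: "G_space_over p \<pi>" and f: "f \<in> Arr C" "Cod C f = Cod C \<pi>"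
    and \<phi>: "\<phi> \<in> Arr C" "Dom C \<phi> = pbo C \<pi> f" "Cod C \<phi> = prd C G (Dom C f)"
    and pr: "pr2 C G (Dom C f) \<cdot> \<phi> = Pb2 C \<pi> f"
  shows "equivariant C G (pulled_action p \<pi> f) (mult_action C G m (Dom C f)) \<phi> \<longleftrightarrow>
    (\<forall>a v. element_pair a v (pbo C \<pi> f) \<longrightarrow>
      pr1 C G (Dom C f) \<cdot> (\<phi> \<cdot> (pulled_action p \<pi> f \<cdot> pairing C a v))
        = m \<cdot> pairing C a (pr1 C G (Dom C f) \<cdot> (\<phi> \<cdot> v)))"
proof -
  note [simp] = G_space_over_props[OF sp] pulled_action_props[OF sp f] f \<phi>
  let ?U = "Dom C f" and ?\<psi> = "pulled_action p \<pi> f"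
  have "\<phi> \<cdot> (?\<psi> \<cdot> pairing C a v) = mult_action C G m ?U \<cdot> pairing C a (\<phi> \<cdot> v) \<longleftrightarrow>
      pr1 C G ?U \<cdot> (\<phi> \<cdot> (?\<psi> \<cdot> pairing C a v)) = m \<cdot> pairing C a (pr1 C G ?U \<cdot> (\<phi> \<cdot> v))"
    (is "?l = ?r \<longleftrightarrow> ?c")
    if av: "element_pair a v (pbo C \<pi> f)" for a v
  proof -
    have r: "?r = pairing C (m \<cdot> pairing C a (pr1 C G ?U \<cdot> (\<phi> \<cdot> v))) (pr2 C G ?U \<cdot> (\<phi> \<cdot> v))"
      using av by (simp add: mult_action_pairing)
    have 2: "pr2 C G ?U \<cdot> (\<phi> \<cdot> w) = Pb2 C \<pi> f \<cdot> w" if "w \<in> Arr C" "Cod C w = pbo C \<pi> f" for w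
      using comp_eq_extend[OF pr, of w] that by simp
    show ?thesis
    proof
      assume "?l = ?r"
      then have "pr1 C G ?U \<cdot> ?l = pr1 C G ?U \<cdot> ?r" by (rule arg_cong)
      then show ?c using av by (simp add: r)
    next
      assume ?c
      show "?l = ?r"
        unfolding r by (rule prd_eqI[of G ?U]) (use av \<open>?c\<close> in \<open>simp_all add: 2\<close>)
    qed
  qed
  then show ?thesis
    by (subst equivariant_iff[where A = "pbo C \<pi> f" and B = "prd C G ?U"])
      (simp_all cong: imp_cong)
qed

lemma trivial_alongI:
  assumes "G_space_over p \<pi>" "f \<in> Arr C" "Cod C f = Cod C \<pi>"
    and \<phi>: "\<phi> \<in> Arr C" "Dom C \<phi> = pbo C \<pi> f" "Cod C \<phi> = prd C G (Dom C f)"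
    and \<theta>: "\<theta> \<in> Arr C" "Dom C \<theta> = prd C G (Dom C f)" "Cod C \<theta> = pbo C \<pi> f"
    and inv: "\<theta> \<cdot> \<phi> = Id C (pbo C \<pi> f)" "\<phi> \<cdot> \<theta> = Id C (prd C G (Dom C f))"
    and pr: "pr2 C G (Dom C f) \<cdot> \<phi> = Pb2 C \<pi> f"
    and eqv: "\<And>a v. element_pair a v (pbo C \<pi> f) \<Longrightarrow>
      pr1 C G (Dom C f) \<cdot> (\<phi> \<cdot> (pulled_action p \<pi> f \<cdot> pairing C a v))
        = m \<cdot> pairing C a (pr1 C G (Dom C f) \<cdot> (\<phi> \<cdot> v))"
  shows "trivial_along p \<pi> f"
  unfolding trivial_along_def
proof (intro bexI[of _ \<phi>] conjI)
  show "is_iso C \<phi>"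
    by (rule is_isoI[of _ \<theta>]) (simp_all add: \<phi> \<theta> inv)
  show "equivariant C G (pulled_action p \<pi> f) (mult_action C G m (Dom C f)) \<phi>"
    using equivariant_into_product_iff[OF assms(1-3) \<phi> pr] eqv by blast
qed (simp_all add: \<phi> pr Hom_iff)

lemma trivial_alongE:
  assumes "G_space_over p \<pi>" "f \<in> Arr C" "Cod C f = Cod C \<pi>" "trivial_along p \<pi> f"
  obtains \<phi> \<theta> where "\<phi> \<in> Arr C" "Dom C \<phi> = pbo C \<pi> f" "Cod C \<phi> = prd C G (Dom C f)"
    "\<theta> \<in> Arr C" "Dom C \<theta> = prd C G (Dom C f)" "Cod C \<theta> = pbo C \<pi> f"
    "\<theta> \<cdot> \<phi> = Id C (pbo C \<pi> f)" "\<phi> \<cdot> \<theta> = Id C (prd C G (Dom C f))"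
    "pr2 C G (Dom C f) \<cdot> \<phi> = Pb2 C \<pi> f"
    "\<And>a v. element_pair a v (pbo C \<pi> f) \<Longrightarrow>
      pr1 C G (Dom C f) \<cdot> (\<phi> \<cdot> (pulled_action p \<pi> f \<cdot> pairing C a v))
        = m \<cdot> pairing C a (pr1 C G (Dom C f) \<cdot> (\<phi> \<cdot> v))"
proof -
  obtain \<phi> where mem: "\<phi> \<in> Hom C (pbo C \<pi> f) (prd C G (Dom C f))" and iso: "is_iso C \<phi>"
    and eqv: "equivariant C G (pulled_action p \<pi> f) (mult_action C G m (Dom C f)) \<phi>"
    and pr: "pr2 C G (Dom C f) \<cdot> \<phi> = Pb2 C \<pi> f"
    using assms(4) unfolding trivial_along_def by (elim bexE conjE) (rule that)
  have \<phi>: "\<phi> \<in> Arr C" "Dom C \<phi> = pbo C \<pi> f" "Cod C \<phi> = prd C G (Dom C f)"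
    using mem by (simp_all add: Hom_iff)
  from iso obtain \<theta> where mem': "\<theta> \<in> Hom C (Cod C \<phi>) (Dom C \<phi>)"
    and inv: "\<theta> \<cdot> \<phi> = Id C (Dom C \<phi>)" "\<phi> \<cdot> \<theta> = Id C (Cod C \<phi>)"
    unfolding is_iso_def by (elim bexE conjE) (rule that)
  have \<theta>: "\<theta> \<in> Arr C" "Dom C \<theta> = prd C G (Dom C f)" "Cod C \<theta> = pbo C \<pi> f"
    using mem' by (simp_all add: Hom_iff \<phi>)
  show thesis
    by (rule that[OF \<phi> \<theta> inv[unfolded \<phi>(2,3)] pr])
      (rule equivariant_into_product_iff[OF assms(1-3) \<phi> pr, THEN iffD1, OF eqv, rule_format])
qed

text \<open>
  Over \<open>V \<rightarrow> U \<rightarrow> Y\<close>, a point of \<open>P \<times>\<^sub>Y V\<close> gives a point of \<open>P \<times>\<^sub>Y U\<close>, and the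
  \<open>G\<close>-coordinate of the latter trivializes \<open>P \<times>\<^sub>Y V\<close>.
\<close>

lemma trivial_along_comp:
  assumes sp: "G_space_over p \<pi>" and u: "u \<in> Arr C" "Cod C u = Cod C \<pi>"
    and k: "k \<in> Arr C" "Cod C k = Dom C u" and triv: "trivial_along p \<pi> u"
  shows "trivial_along p \<pi> (u \<cdot> k)"
proof -
  note uk = comp_arr[OF k(1) u(1) k(2)]
  have cod_uk: "Cod C (u \<cdot> k) = Cod C \<pi>" using uk u by simp
  note [simp] = G_space_over_props[OF sp] G_space_over_invariant[OF sp] u k pulled_action_props[OF sp u]
    pulled_action_props[OF sp uk(1) cod_uk, unfolded uk(2)]
  let ?U = "Dom C u" and ?V = "Dom C k"
  \<comment> \<open>the equivariant comparison \<open>P \<times>\<^sub>Y V \<rightarrow> P \<times>\<^sub>Y U\<close> induced by \<open>k\<close>\<close>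
  define \<kappa> where "\<kappa> = pb_lift C \<pi> u (Pb1 C \<pi> (u \<cdot> k)) (k \<cdot> Pb2 C \<pi> (u \<cdot> k))"
  let ?\<psi> = "pulled_action p \<pi> u" and ?\<psi>' = "pullback_action C G p (trivial_action C G ?V) \<pi> (u \<cdot> k)"
  obtain \<phi> \<theta> where [simp]: "\<phi> \<in> Arr C" "Dom C \<phi> = pbo C \<pi> u" "Cod C \<phi> = prd C G ?U"
      "\<theta> \<in> Arr C" "Dom C \<theta> = prd C G ?U" "Cod C \<theta> = pbo C \<pi> u"
    and \<theta>\<phi>: "\<theta> \<cdot> \<phi> = Id C (pbo C \<pi> u)" and \<phi>\<theta>: "\<phi> \<cdot> \<theta> = Id C (prd C G ?U)"
    and pr\<phi>: "pr2 C G ?U \<cdot> \<phi> = Pb2 C \<pi> u"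
    and eqv: "\<And>a v. element_pair a v (pbo C \<pi> u) \<Longrightarrow>
       pr1 C G ?U \<cdot> (\<phi> \<cdot> (?\<psi> \<cdot> pairing C a v)) = m \<cdot> pairing C a (pr1 C G ?U \<cdot> (\<phi> \<cdot> v))"
    by (rule trivial_alongE[OF sp u triv]) (rule that)
  have [simp]: "\<theta> \<cdot> (\<phi> \<cdot> w) = w" if "w \<in> Arr C" "Cod C w = pbo C \<pi> u" for w
    using comp_eq_extend[OF \<theta>\<phi>, of w] that by simp
  have [simp]: "\<phi> \<cdot> (\<theta> \<cdot> w) = w" if "w \<in> Arr C" "Cod C w = prd C G ?U" for w
    using comp_eq_extend[OF \<phi>\<theta>, of w] that by simp
  have pr\<phi>' [simp]: "pr2 C G ?U \<cdot> (\<phi> \<cdot> w) = Pb2 C \<pi> u \<cdot> w" if "w \<in> Arr C" "Cod C w = pbo C \<pi> u" for w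
    using comp_eq_extend[OF pr\<phi>, of w] that by simp
  have pr\<theta> [simp]: "Pb2 C \<pi> u \<cdot> (\<theta> \<cdot> w) = pr2 C G ?U \<cdot> w" if "w \<in> Arr C" "Cod C w = prd C G ?U" for w
    using pr\<phi>'[of "\<theta> \<cdot> w"] that by simp
  have \<kappa> [simp]: "\<kappa> \<in> Arr C" "Dom C \<kappa> = pbo C \<pi> (u \<cdot> k)" "Cod C \<kappa> = pbo C \<pi> u"
    "Pb1 C \<pi> u \<cdot> \<kappa> = Pb1 C \<pi> (u \<cdot> k)" "Pb2 C \<pi> u \<cdot> \<kappa> = k \<cdot> Pb2 C \<pi> (u \<cdot> k)"
    by (simp_all add: \<kappa>_def)
  have [simp]: "Pb1 C \<pi> u \<cdot> (\<kappa> \<cdot> w) = Pb1 C \<pi> (u \<cdot> k) \<cdot> w"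
    "Pb2 C \<pi> u \<cdot> (\<kappa> \<cdot> w) = k \<cdot> (Pb2 C \<pi> (u \<cdot> k) \<cdot> w)"
    if "w \<in> Arr C" "Cod C w = pbo C \<pi> (u \<cdot> k)" for w
    using comp_eq_extend[OF \<kappa>(4), of w] comp_eq_extend[OF \<kappa>(5), of w] that by simp_all
  have \<kappa>_eqv: "\<kappa> \<cdot> (?\<psi>' \<cdot> pairing C a v) = ?\<psi> \<cdot> pairing C a (\<kappa> \<cdot> v)"
    if "element_pair a v (pbo C \<pi> (u \<cdot> k))" for a v
    by (rule pb_eqI[of \<pi> u]) (use that in simp_all)
  \<comment> \<open>The maps \<open>\<Phi>\<close> and \<open>\<Theta>\<close> are the base changes along \<open>k\<close> of \<open>\<phi>\<close> and \<open>\<theta>\<close>; \<open>s\<close> is \<open>id \<times> k\<close>.\<close>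
  define \<Phi> where "\<Phi> = pairing C (pr1 C G ?U \<cdot> (\<phi> \<cdot> \<kappa>)) (Pb2 C \<pi> (u \<cdot> k))"
  define s where "s = pairing C (pr1 C G ?V) (k \<cdot> pr2 C G ?V)"
  define \<Theta> where "\<Theta> = pb_lift C \<pi> (u \<cdot> k) (Pb1 C \<pi> u \<cdot> (\<theta> \<cdot> s)) (pr2 C G ?V)"
  have s [simp]: "s \<in> Arr C" "Dom C s = prd C G ?V" "Cod C s = prd C G ?U"
    "pr1 C G ?U \<cdot> s = pr1 C G ?V" "pr2 C G ?U \<cdot> s = k \<cdot> pr2 C G ?V"
    by (simp_all add: s_def)
  have \<Phi> [simp]: "\<Phi> \<in> Arr C" "Dom C \<Phi> = pbo C \<pi> (u \<cdot> k)" "Cod C \<Phi> = prd C G ?V"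
    by (simp_all add: \<Phi>_def)
  have \<Theta> [simp]: "\<Theta> \<in> Arr C" "Dom C \<Theta> = prd C G ?V" "Cod C \<Theta> = pbo C \<pi> (u \<cdot> k)"
    "Pb1 C \<pi> (u \<cdot> k) \<cdot> \<Theta> = Pb1 C \<pi> u \<cdot> (\<theta> \<cdot> s)" "Pb2 C \<pi> (u \<cdot> k) \<cdot> \<Theta> = pr2 C G ?V"
    by (simp_all add: \<Theta>_def)
  have \<kappa>\<Theta>: "\<kappa> \<cdot> \<Theta> = \<theta> \<cdot> s"
    by (rule pb_eqI[of \<pi> u]) simp_all
  have s\<Phi>: "s \<cdot> \<Phi> = \<phi> \<cdot> \<kappa>"
    by (rule prd_eqI[of G ?U]) (simp_all add: s_def \<Phi>_def)
  have "\<Phi> \<cdot> \<Theta> = Id C (prd C G ?V)"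
    by (rule prd_eqI[of G ?V]) (simp_all add: \<Phi>_def \<kappa>\<Theta>)
  moreover have "\<Theta> \<cdot> \<Phi> = Id C (pbo C \<pi> (u \<cdot> k))"
  proof (rule pb_eqI[of \<pi> "u \<cdot> k"])
    show "Pb1 C \<pi> (u \<cdot> k) \<cdot> \<Theta> \<cdot> \<Phi> = Pb1 C \<pi> (u \<cdot> k) \<cdot> Id C (pbo C \<pi> (u \<cdot> k))"
      using comp_eq_extend[OF \<Theta>(4), of \<Phi>] by (simp add: s\<Phi>)
    show "Pb2 C \<pi> (u \<cdot> k) \<cdot> \<Theta> \<cdot> \<Phi> = Pb2 C \<pi> (u \<cdot> k) \<cdot> Id C (pbo C \<pi> (u \<cdot> k))"
      using comp_eq_extend[OF \<Theta>(5), of \<Phi>] by (simp add: \<Phi>_def)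
  qed simp_all
  moreover have "pr2 C G ?V \<cdot> \<Phi> = Pb2 C \<pi> (u \<cdot> k)"
    by (simp add: \<Phi>_def)
  moreover have "pr1 C G ?V \<cdot> (\<Phi> \<cdot> (?\<psi>' \<cdot> pairing C a v)) = m \<cdot> pairing C a (pr1 C G ?V \<cdot> (\<Phi> \<cdot> v))"
    if "element_pair a v (pbo C \<pi> (u \<cdot> k))" for a v
    using that eqv[of a "\<kappa> \<cdot> v"] by (simp add: \<Phi>_def \<kappa>_eqv)
  ultimately show ?thesis
    by (intro trivial_alongI[OF sp uk(1) cod_uk, unfolded uk(2), OF \<Phi> \<Theta>(1-3)]) simp_all
qed

text \<open>
  The canonical isomorphism \<open>(P \<times>\<^sub>Y Z) \<times>\<^sub>Z W \<rightarrow> P \<times>\<^sub>Y W\<close>, with its inverse \<open>d\<close> written out. It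
  serves twice: to transport trivializations, and as the composition constraint of the pseudofunctor.
\<close>

lemma iterated_pullback:
  assumes sp: "G_space_over p \<pi>" and f: "f \<in> Arr C" "Cod C f = Cod C \<pi>"
    and g: "g \<in> Arr C" "Cod C g = Dom C f"
  defines "c \<equiv> pb_lift C \<pi> (f \<cdot> g) (Pb1 C \<pi> f \<cdot> Pb1 C (Pb2 C \<pi> f) g) (Pb2 C (Pb2 C \<pi> f) g)"
    and "d \<equiv> pb_lift C (Pb2 C \<pi> f) g
      (pb_lift C \<pi> f (Pb1 C \<pi> (f \<cdot> g)) (g \<cdot> Pb2 C \<pi> (f \<cdot> g))) (Pb2 C \<pi> (f \<cdot> g))"
  shows "c \<in> Arr C" "Dom C c = pbo C (Pb2 C \<pi> f) g" "Cod C c = pbo C \<pi> (f \<cdot> g)"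
    "d \<in> Arr C" "Dom C d = pbo C \<pi> (f \<cdot> g)" "Cod C d = pbo C (Pb2 C \<pi> f) g"
    "d \<cdot> c = Id C (pbo C (Pb2 C \<pi> f) g)" "c \<cdot> d = Id C (pbo C \<pi> (f \<cdot> g))"
    "Pb1 C \<pi> (f \<cdot> g) \<cdot> c = Pb1 C \<pi> f \<cdot> Pb1 C (Pb2 C \<pi> f) g"
    "Pb2 C \<pi> (f \<cdot> g) \<cdot> c = Pb2 C (Pb2 C \<pi> f) g"
    "\<And>a v. element_pair a v (pbo C (Pb2 C \<pi> f) g) \<Longrightarrow>
      c \<cdot> (pulled_action (pulled_action p \<pi> f) (Pb2 C \<pi> f) g \<cdot> pairing C a v)
        = pulled_action p \<pi> (f \<cdot> g) \<cdot> pairing C a (c \<cdot> v)"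
proof -
  note fg = comp_arr[OF g(1) f(1) g(2)]
  have cod_fg: "Cod C (f \<cdot> g) = Cod C \<pi>" using fg f by simp
  have g': "Cod C g = Cod C (Pb2 C \<pi> f)"
    using f g G_space_over_props[OF sp] by simp
  note [simp] = G_space_over_props[OF sp] G_space_over_invariant[OF sp] f g pulled_action_props[OF sp f]
    pulled_action_props[OF sp fg(1) cod_fg, unfolded fg(2)]
    pulled_action_props[OF G_space_over_pullback[OF sp f] g(1) g']
  show c [simp]: "c \<in> Arr C" "Dom C c = pbo C (Pb2 C \<pi> f) g" "Cod C c = pbo C \<pi> (f \<cdot> g)"
      "Pb1 C \<pi> (f \<cdot> g) \<cdot> c = Pb1 C \<pi> f \<cdot> Pb1 C (Pb2 C \<pi> f) g"
      "Pb2 C \<pi> (f \<cdot> g) \<cdot> c = Pb2 C (Pb2 C \<pi> f) g"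
    by (simp_all add: c_def)
  have c' [simp]: "Pb1 C \<pi> (f \<cdot> g) \<cdot> (c \<cdot> w) = Pb1 C \<pi> f \<cdot> (Pb1 C (Pb2 C \<pi> f) g \<cdot> w)"
    "Pb2 C \<pi> (f \<cdot> g) \<cdot> (c \<cdot> w) = Pb2 C (Pb2 C \<pi> f) g \<cdot> w"
    if "w \<in> Arr C" "Cod C w = pbo C (Pb2 C \<pi> f) g" for w
    using comp_eq_extend[OF c(4), of w] comp_eq_extend[OF c(5), of w] that by simp_all
  define l where "l = pb_lift C \<pi> f (Pb1 C \<pi> (f \<cdot> g)) (g \<cdot> Pb2 C \<pi> (f \<cdot> g))"
  have l [simp]: "l \<in> Arr C" "Dom C l = pbo C \<pi> (f \<cdot> g)" "Cod C l = pbo C \<pi> f"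
      "Pb1 C \<pi> f \<cdot> l = Pb1 C \<pi> (f \<cdot> g)" "Pb2 C \<pi> f \<cdot> l = g \<cdot> Pb2 C \<pi> (f \<cdot> g)"
    by (simp_all add: l_def)
  have d_l: "d = pb_lift C (Pb2 C \<pi> f) g l (Pb2 C \<pi> (f \<cdot> g))"
    by (simp only: d_def l_def)
  show d [simp]: "d \<in> Arr C" "Dom C d = pbo C \<pi> (f \<cdot> g)" "Cod C d = pbo C (Pb2 C \<pi> f) g"
    by (simp_all add: d_l)
  have d' [simp]: "Pb1 C (Pb2 C \<pi> f) g \<cdot> d = l" "Pb2 C (Pb2 C \<pi> f) g \<cdot> d = Pb2 C \<pi> (f \<cdot> g)"
    by (simp_all add: d_l)
  show "c \<cdot> d = Id C (pbo C \<pi> (f \<cdot> g))"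
    by (rule pb_eqI[of \<pi> "f \<cdot> g"]) simp_all
  have lc: "l \<cdot> c = Pb1 C (Pb2 C \<pi> f) g"
  proof (rule pb_eqI[of \<pi> f])
    show "Pb1 C \<pi> f \<cdot> l \<cdot> c = Pb1 C \<pi> f \<cdot> Pb1 C (Pb2 C \<pi> f) g"
      using comp_eq_extend[OF l(4), of c] by simp
    show "Pb2 C \<pi> f \<cdot> l \<cdot> c = Pb2 C \<pi> f \<cdot> Pb1 C (Pb2 C \<pi> f) g"
      using comp_eq_extend[OF l(5), of c] by simp
  qed simp_all
  show "d \<cdot> c = Id C (pbo C (Pb2 C \<pi> f) g)"
  proof (rule pb_eqI[of "Pb2 C \<pi> f" g])
    show "Pb1 C (Pb2 C \<pi> f) g \<cdot> d \<cdot> c = Pb1 C (Pb2 C \<pi> f) g \<cdot> Id C (pbo C (Pb2 C \<pi> f) g)"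
      using comp_eq_extend[OF d'(1), of c] by (simp add: lc)
    show "Pb2 C (Pb2 C \<pi> f) g \<cdot> d \<cdot> c = Pb2 C (Pb2 C \<pi> f) g \<cdot> Id C (pbo C (Pb2 C \<pi> f) g)"
      using comp_eq_extend[OF d'(2), of c] by simp
  qed simp_all
  show "c \<cdot> (pulled_action (pulled_action p \<pi> f) (Pb2 C \<pi> f) g \<cdot> pairing C a v)
        = pulled_action p \<pi> (f \<cdot> g) \<cdot> pairing C a (c \<cdot> v)"
    if "element_pair a v (pbo C (Pb2 C \<pi> f) g)" for a v
    by (rule pb_eqI[of \<pi> "f \<cdot> g"]) (use that in simp_all)
qed

lemma trivial_along_pullback:
  assumes sp: "G_space_over p \<pi>" and f: "f \<in> Arr C" "Cod C f = Cod C \<pi>"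
    and g: "g \<in> Arr C" "Cod C g = Dom C f" and triv: "trivial_along p \<pi> (f \<cdot> g)"
  shows "trivial_along (pulled_action p \<pi> f) (Pb2 C \<pi> f) g"
proof -
  note fg = comp_arr[OF g(1) f(1) g(2)]
  have cod_fg: "Cod C (f \<cdot> g) = Cod C \<pi>" using fg f by simp
  have g': "Cod C g = Cod C (Pb2 C \<pi> f)"
    using f g G_space_over_props[OF sp] by simp
  note sp' = G_space_over_pullback[OF sp f]
  note [simp] = G_space_over_props[OF sp] G_space_over_invariant[OF sp] f g pulled_action_props[OF sp f]
    pulled_action_props[OF sp fg(1) cod_fg, unfolded fg(2)]
    pulled_action_props[OF sp' g(1) g']
  let ?V = "Dom C g"
  define c where "c = pb_lift C \<pi> (f \<cdot> g) (Pb1 C \<pi> f \<cdot> Pb1 C (Pb2 C \<pi> f) g) (Pb2 C (Pb2 C \<pi> f) g)"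
  define d where "d = pb_lift C (Pb2 C \<pi> f) g
      (pb_lift C \<pi> f (Pb1 C \<pi> (f \<cdot> g)) (g \<cdot> Pb2 C \<pi> (f \<cdot> g))) (Pb2 C \<pi> (f \<cdot> g))"
  note cd = iterated_pullback[OF sp f g, folded c_def d_def, unfolded fg(2)]
  note [simp] = cd(1-6)
  have [simp]: "d \<cdot> (c \<cdot> w) = w" if "w \<in> Arr C" "Cod C w = pbo C (Pb2 C \<pi> f) g" for w
    using comp_eq_extend[OF cd(7), of w] that by simp
  have [simp]: "c \<cdot> (d \<cdot> w) = w" if "w \<in> Arr C" "Cod C w = pbo C \<pi> (f \<cdot> g)" for w
    using comp_eq_extend[OF cd(8), of w] that by simp
  obtain \<phi> \<theta> where [simp]: "\<phi> \<in> Arr C" "Dom C \<phi> = pbo C \<pi> (f \<cdot> g)" "Cod C \<phi> = prd C G ?V"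
      "\<theta> \<in> Arr C" "Dom C \<theta> = prd C G ?V" "Cod C \<theta> = pbo C \<pi> (f \<cdot> g)"
    and \<theta>\<phi>: "\<theta> \<cdot> \<phi> = Id C (pbo C \<pi> (f \<cdot> g))" and \<phi>\<theta>: "\<phi> \<cdot> \<theta> = Id C (prd C G ?V)"
    and pr\<phi>: "pr2 C G ?V \<cdot> \<phi> = Pb2 C \<pi> (f \<cdot> g)"
    and eqv: "\<And>a v. element_pair a v (pbo C \<pi> (f \<cdot> g)) \<Longrightarrow>
       pr1 C G ?V \<cdot> (\<phi> \<cdot> (pullback_action C G p (trivial_action C G ?V) \<pi> (f \<cdot> g) \<cdot> pairing C a v))
       = m \<cdot> pairing C a (pr1 C G ?V \<cdot> (\<phi> \<cdot> v))"
    by (rule trivial_alongE[OF sp fg(1) cod_fg triv, unfolded fg(2)]) (rule that)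
  have [simp]: "\<theta> \<cdot> (\<phi> \<cdot> w) = w" if "w \<in> Arr C" "Cod C w = pbo C \<pi> (f \<cdot> g)" for w
    using comp_eq_extend[OF \<theta>\<phi>, of w] that by simp
  have pr\<phi>': "pr2 C G ?V \<cdot> (\<phi> \<cdot> w) = Pb2 C \<pi> (f \<cdot> g) \<cdot> w" if "w \<in> Arr C" "Cod C w = pbo C \<pi> (f \<cdot> g)" for w
    using comp_eq_extend[OF pr\<phi>, of w] that by simp
  show ?thesis
  proof (rule trivial_alongI[OF sp' g(1) g', of "\<phi> \<cdot> c" "d \<cdot> \<theta>"])
    fix a v assume "element_pair a v (pbo C (Pb2 C \<pi> f) g)"
    then show "pr1 C G ?V \<cdot> ((\<phi> \<cdot> c) \<cdot> (pulled_action (pulled_action p \<pi> f) (Pb2 C \<pi> f) g \<cdot> pairing C a v))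
         = m \<cdot> pairing C a (pr1 C G ?V \<cdot> ((\<phi> \<cdot> c) \<cdot> v))"
      by (simp add: cd(11) eqv)
  qed (simp_all add: cd(7) \<phi>\<theta> pr\<phi>' cd(10))
qed

text \<open>
  Stability of the topology applies directly: by the universal property of \<open>Z \<times>\<^sub>Y U\<close>, a map \<open>h\<close> into
  \<open>Z\<close> factors through some \<open>Z \<times>\<^sub>Y U \<rightarrow> Z\<close> if and only if \<open>f \<cdot> h\<close> factors through the corresponding
  \<open>u : U \<rightarrow> Y\<close>.
\<close>

lemma covering_family_pullback:
  assumes "grothendieck_topology C \<tau>" and f: "f \<in> Arr C"
    and cov: "covering_family C \<tau> (Cod C f) \<U>"
  shows "covering_family C \<tau> (Dom C f) (Pb1 C f ` \<U>)"
proof -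
  interpret grothendieck_topology C \<tau> by fact
  have U: "u \<in> Arr C" "Cod C u = Cod C f" if "u \<in> \<U>" for u
    using cov that by (auto simp: covering_family_def)
  have "generated_sieve C (Pb1 C f ` \<U>) = pull_sieve C f (generated_sieve C \<U>)"
  proof (intro set_eqI iffI)
    fix h assume "h \<in> generated_sieve C (Pb1 C f ` \<U>)"
    then obtain u k where u: "u \<in> \<U>" and k: "k \<in> Arr C" "Cod C k = Dom C (Pb1 C f u)"
      and h: "h = Pb1 C f u \<cdot> k"
      unfolding generated_sieve_def by auto
    have "f \<cdot> h = u \<cdot> (Pb2 C f u \<cdot> k)"
      using f U[OF u] k by (simp add: h)
    moreover have "h \<in> Arr C" "Cod C h = Dom C f" "Pb2 C f u \<cdot> k \<in> Arr C"
      "Cod C (Pb2 C f u \<cdot> k) = Dom C u"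
      using f U[OF u] k by (simp_all add: h)
    ultimately show "h \<in> pull_sieve C f (generated_sieve C \<U>)"
      using u unfolding pull_sieve_def generated_sieve_def by blast
  next
    fix h assume "h \<in> pull_sieve C f (generated_sieve C \<U>)"
    then obtain u k where h: "h \<in> Arr C" "Cod C h = Dom C f" and u: "u \<in> \<U>"
      and k: "k \<in> Arr C" "Cod C k = Dom C u" and eq: "f \<cdot> h = u \<cdot> k"
      unfolding pull_sieve_def generated_sieve_def by auto
    have dom: "Dom C h = Dom C k"
      using arg_cong[OF eq, of "Dom C"] f h k U[OF u] by simp
    let ?l = "pb_lift C f u h k"
    have "h = Pb1 C f u \<cdot> ?l" "?l \<in> Arr C" "Cod C ?l = Dom C (Pb1 C f u)"
      using f h k U[OF u] eq dom by simp_all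
    then show "h \<in> generated_sieve C (Pb1 C f ` \<U>)"
      using u unfolding generated_sieve_def by blast
  qed
  moreover have "pull_sieve C f (generated_sieve C \<U>) \<in> \<tau> (Dom C f)"
    using cov f by (intro stable[of f _ "Cod C f"]) (auto simp: covering_family_def Hom_iff)
  ultimately show ?thesis
    using f U unfolding covering_family_def by auto
qed

lemma locally_trivial_pullback:
  assumes \<tau>: "grothendieck_topology C \<tau>" and sp: "G_space_over p \<pi>"
    and f: "f \<in> Arr C" "Cod C f = Cod C \<pi>"
    and "locally_trivial C \<tau> G m (Cod C \<pi>) p \<pi>"
  shows "locally_trivial C \<tau> G m (Dom C f) (pulled_action p \<pi> f) (Pb2 C \<pi> f)"
proof -
  obtain \<U> where cov: "covering_family C \<tau> (Cod C f) \<U>" and triv: "\<And>u. u \<in> \<U> \<Longrightarrow> trivial_along p \<pi> u"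
    using assms(5) f unfolding locally_trivial_iff by auto
  have "trivial_along (pulled_action p \<pi> f) (Pb2 C \<pi> f) (Pb1 C f u)" if u: "u \<in> \<U>" for u
  proof -
    have U: "u \<in> Arr C" "Cod C u = Cod C \<pi>"
      using cov u f by (auto simp: covering_family_def)
    \<comment> \<open>The two composites \<open>Z \<times>\<^sub>Y U \<rightarrow> Y\<close> agree, so the trivialization over \<open>U\<close> can be read over \<open>Z\<close>.\<close>
    have "trivial_along p \<pi> (u \<cdot> Pb2 C f u)"
      by (rule trivial_along_comp[OF sp U _ _ triv[OF u]]) (use f U in simp_all)
    then have "trivial_along p \<pi> (f \<cdot> Pb1 C f u)"
      using f U by simp
    then show ?thesis
      by (intro trivial_along_pullback[OF sp f]) (use f U in simp_all)
  qed
  then show ?thesis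
    using covering_family_pullback[OF \<tau> f(1) cov] unfolding locally_trivial_iff by blast
qed


section \<open>The categories of bundles with an equivariant map\<close>


lemma qobj_iff:
  assumes "group_action C G m e X x"
  shows "A \<in> qobj C \<tau> G m e X x Y \<longleftrightarrow>
    G_space_over (Act A) (Proj A) \<and> Dom C (Proj A) = Tot A \<and> Cod C (Proj A) = Y \<and>
    locally_trivial C \<tau> G m Y (Act A) (Proj A) \<and>
    Map A \<in> Arr C \<and> Dom C (Map A) = Tot A \<and> Cod C (Map A) = X \<and>
    (\<forall>a u. element_pair a u (Tot A) \<longrightarrow>
      Map A \<cdot> (Act A \<cdot> pairing C a u) = x \<cdot> pairing C a (Map A \<cdot> u))"
proof -
  have x: "x \<in> Arr C" "Dom C x = prd C G X"
    using assms by (simp_all add: group_action_iff)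
  have "equivariant C G (Act A) x (Map A) \<longleftrightarrow> (\<forall>a u. element_pair a u (Tot A) \<longrightarrow>
      Map A \<cdot> (Act A \<cdot> pairing C a u) = x \<cdot> pairing C a (Map A \<cdot> u))"
    if "G_space_over (Act A) (Proj A)" "Dom C (Proj A) = Tot A" "Map A \<in> Hom C (Tot A) X"
    using that x G_space_over_props[OF that(1)] unfolding Hom_iff by (intro equivariant_iff) simp_all
  moreover have "principal_bundle C \<tau> G m e Y (Tot A) (Act A) (Proj A) \<longleftrightarrow>
      (G_space_over (Act A) (Proj A) \<and> Dom C (Proj A) = Tot A \<and> Cod C (Proj A) = Y) \<and>
      locally_trivial C \<tau> G m Y (Act A) (Proj A)"
    unfolding principal_bundle_def G_space_over_iff[symmetric] by blast
  ultimately show ?thesis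
    unfolding qobj_def Hom_iff by blast
qed

lemma qobjD:
  assumes "group_action C G m e X x" "A \<in> qobj C \<tau> G m e X x Y"
  shows "Proj A \<in> Arr C" "Dom C (Proj A) = Tot A" "Cod C (Proj A) = Y"
    "Act A \<in> Arr C" "Dom C (Act A) = prd C G (Tot A)" "Cod C (Act A) = Tot A"
    "Map A \<in> Arr C" "Dom C (Map A) = Tot A" "Cod C (Map A) = X" "Tot A \<in> Obj C"
    "G_space_over (Act A) (Proj A)"
    "\<And>a u. element_pair a u (Tot A) \<Longrightarrow> Proj A \<cdot> (Act A \<cdot> pairing C a u) = Proj A \<cdot> u"
    "\<And>a u. element_pair a u (Tot A) \<Longrightarrow>
      Map A \<cdot> (Act A \<cdot> pairing C a u) = x \<cdot> pairing C a (Map A \<cdot> u)"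
proof -
  note A = assms(2)[unfolded qobj_iff[OF assms(1)]]
  note sp = G_space_over_props[of "Act A" "Proj A"]
  show "Proj A \<in> Arr C" "Dom C (Proj A) = Tot A" "Cod C (Proj A) = Y"
    "Act A \<in> Arr C" "Dom C (Act A) = prd C G (Tot A)" "Cod C (Act A) = Tot A"
    "Map A \<in> Arr C" "Dom C (Map A) = Tot A" "Cod C (Map A) = X"
    "G_space_over (Act A) (Proj A)"
    using A sp by simp_all
  then show "Tot A \<in> Obj C"
    using dom_obj[of "Proj A"] by simp
  show "Proj A \<cdot> (Act A \<cdot> pairing C a u) = Proj A \<cdot> u" if "element_pair a u (Tot A)" for a u
    using A that by (intro G_space_over_invariant) simp_all
  show "Map A \<cdot> (Act A \<cdot> pairing C a u) = x \<cdot> pairing C a (Map A \<cdot> u)"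
    if "element_pair a u (Tot A)" for a u
    using A that by blast
qed

lemma qarr_iff:
  assumes "group_action C G m e X x"
  shows "(A, \<phi>, B) \<in> qarr C \<tau> G m e X x Y \<longleftrightarrow>
    A \<in> qobj C \<tau> G m e X x Y \<and> B \<in> qobj C \<tau> G m e X x Y \<and>
    \<phi> \<in> Arr C \<and> Dom C \<phi> = Tot A \<and> Cod C \<phi> = Tot B \<and> Proj B \<cdot> \<phi> = Proj A \<and> Map B \<cdot> \<phi> = Map A \<and>
    (\<forall>a u. element_pair a u (Tot A) \<longrightarrow>
      \<phi> \<cdot> (Act A \<cdot> pairing C a u) = Act B \<cdot> pairing C a (\<phi> \<cdot> u))"
proof -
  have "equivariant C G (Act A) (Act B) \<phi> \<longleftrightarrow> (\<forall>a u. element_pair a u (Tot A) \<longrightarrow>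
      \<phi> \<cdot> (Act A \<cdot> pairing C a u) = Act B \<cdot> pairing C a (\<phi> \<cdot> u))"
    if "A \<in> qobj C \<tau> G m e X x Y" "B \<in> qobj C \<tau> G m e X x Y" "\<phi> \<in> Hom C (Tot A) (Tot B)"
    using that(3) qobjD[OF assms that(1)] qobjD[OF assms that(2)] unfolding Hom_iff
    by (intro equivariant_iff) simp_all
  then show ?thesis
    unfolding qarr_def bundle_morphism_def Hom_iff by blast
qed

end

locale quotient_setting = group_setting C G m e + grothendieck_topology C \<tau>
  for C :: "('o, 'a) pbcat" (structure)
    and \<tau> :: "'o \<Rightarrow> 'a set set"
    and G :: 'o and m e :: 'a +
  fixes X :: 'o and x :: 'a
  assumes action: "group_action C G m e X x"
begin

abbreviation Q :: "'o \<Rightarrow> (('o, 'a) bundle_over, ('o, 'a) bundle_arr) cat" where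
  "Q \<equiv> qcat C \<tau> G m e X x"

lemma action_arr [simp]:
  "X \<in> Obj C" "x \<in> Arr C" "Dom C x = prd C G X" "Cod C x = X"
  using action by (simp_all add: group_action_iff)

lemma Q_simps [simp]:
  "Obj (Q Y) = qobj C \<tau> G m e X x Y"
  "Arr (Q Y) = qarr C \<tau> G m e X x Y"
  "Dom (Q Y) (A, \<phi>, B) = A"
  "Cod (Q Y) (A, \<phi>, B) = B"
  "Id (Q Y) A = (A, Id C (Tot A), A)"
  "Cmp (Q Y) (B', \<psi>, D) (A, \<phi>, B) = (A, \<psi> \<cdot> \<phi>, D)"
  by (simp_all add: qcat_def)

lemma Q_objD:
  assumes "A \<in> Obj (Q Y)"
  shows "Proj A \<in> Arr C" "Dom C (Proj A) = Tot A" "Cod C (Proj A) = Y"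
    "Act A \<in> Arr C" "Dom C (Act A) = prd C G (Tot A)" "Cod C (Act A) = Tot A"
    "Map A \<in> Arr C" "Dom C (Map A) = Tot A" "Cod C (Map A) = X" "Tot A \<in> Obj C"
    "G_space_over (Act A) (Proj A)"
    "\<And>a u. element_pair a u (Tot A) \<Longrightarrow> Proj A \<cdot> (Act A \<cdot> pairing C a u) = Proj A \<cdot> u"
    "\<And>a u. element_pair a u (Tot A) \<Longrightarrow>
      Map A \<cdot> (Act A \<cdot> pairing C a u) = x \<cdot> pairing C a (Map A \<cdot> u)"
  using qobjD[OF action assms[simplified]] by blast+

lemma Q_Hom_iff:
  "t \<in> Hom (Q Y) A B \<longleftrightarrow> (\<exists>\<phi>. t = (A, \<phi>, B) \<and> (A, \<phi>, B) \<in> Arr (Q Y))"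
  by (cases t) (auto simp: Hom_def)

lemma Q_arrD:
  assumes "(A, \<phi>, B) \<in> Arr (Q Y)"
  shows "A \<in> Obj (Q Y)" "B \<in> Obj (Q Y)" "\<phi> \<in> Arr C" "Dom C \<phi> = Tot A" "Cod C \<phi> = Tot B"
    "Proj B \<cdot> \<phi> = Proj A" "Map B \<cdot> \<phi> = Map A"
    "\<And>u. \<lbrakk>u \<in> Arr C; Cod C u = Tot A\<rbrakk> \<Longrightarrow> Proj B \<cdot> (\<phi> \<cdot> u) = Proj A \<cdot> u"
    "\<And>u. \<lbrakk>u \<in> Arr C; Cod C u = Tot A\<rbrakk> \<Longrightarrow> Map B \<cdot> (\<phi> \<cdot> u) = Map A \<cdot> u"
    "\<And>a u. element_pair a u (Tot A) \<Longrightarrow>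
      \<phi> \<cdot> (Act A \<cdot> pairing C a u) = Act B \<cdot> pairing C a (\<phi> \<cdot> u)"
proof -
  note t = assms[simplified, unfolded qarr_iff[OF action]]
  show AB: "A \<in> Obj (Q Y)" "B \<in> Obj (Q Y)"
    and \<phi>: "\<phi> \<in> Arr C" "Dom C \<phi> = Tot A" "Cod C \<phi> = Tot B"
      "Proj B \<cdot> \<phi> = Proj A" "Map B \<cdot> \<phi> = Map A"
    using t by simp_all
  show "\<phi> \<cdot> (Act A \<cdot> pairing C a u) = Act B \<cdot> pairing C a (\<phi> \<cdot> u)"
    if "element_pair a u (Tot A)" for a u
    using t that by blast
  show "Proj B \<cdot> (\<phi> \<cdot> u) = Proj A \<cdot> u" if "u \<in> Arr C" "Cod C u = Tot A" for u
    using \<phi> that Q_objD[OF AB(2)] by (intro comp_eq_extend) simp_all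
  show "Map B \<cdot> (\<phi> \<cdot> u) = Map A \<cdot> u" if "u \<in> Arr C" "Cod C u = Tot A" for u
    using \<phi> that Q_objD[OF AB(2)] by (intro comp_eq_extend) simp_all
qed

lemma Q_arrI:
  assumes "A \<in> Obj (Q Y)" "B \<in> Obj (Q Y)" "\<phi> \<in> Arr C" "Dom C \<phi> = Tot A" "Cod C \<phi> = Tot B"
    "Proj B \<cdot> \<phi> = Proj A" "Map B \<cdot> \<phi> = Map A"
    "\<And>a u. element_pair a u (Tot A) \<Longrightarrow>
      \<phi> \<cdot> (Act A \<cdot> pairing C a u) = Act B \<cdot> pairing C a (\<phi> \<cdot> u)"
  shows "(A, \<phi>, B) \<in> Arr (Q Y)"
  using assms by (simp add: qarr_iff[OF action])

lemma Q_category: "category (Q Y)"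
proof
  show "Dom (Q Y) t \<in> Obj (Q Y)" "Cod (Q Y) t \<in> Obj (Q Y)" if "t \<in> Arr (Q Y)" for t
    using that Q_arrD by (cases t; simp)+
  show "Id (Q Y) A \<in> Hom (Q Y) A A" if A: "A \<in> Obj (Q Y)" for A
  proof -
    note [simp] = Q_objD[OF A]
    have "(A, Id C (Tot A), A) \<in> Arr (Q Y)"
      by (rule Q_arrI[OF A A]) simp_all
    then show ?thesis by (simp add: Q_Hom_iff)
  qed
  show "Cmp (Q Y) t s \<in> Hom (Q Y) A D" if s: "s \<in> Hom (Q Y) A B" and t: "t \<in> Hom (Q Y) B D"
    for s t A B D
  proof -
    obtain \<phi> \<psi> where eq: "s = (A, \<phi>, B)" "t = (B, \<psi>, D)"
      and \<phi>: "(A, \<phi>, B) \<in> Arr (Q Y)" and \<psi>: "(B, \<psi>, D) \<in> Arr (Q Y)"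
      using s t by (auto simp: Q_Hom_iff)
    note [simp] = Q_arrD(3-)[OF \<phi>] Q_arrD(3-)[OF \<psi>] Q_objD[OF Q_arrD(1)[OF \<phi>]]
      Q_objD[OF Q_arrD(2)[OF \<phi>]] Q_objD[OF Q_arrD(2)[OF \<psi>]]
    have "(A, \<psi> \<cdot> \<phi>, D) \<in> Arr (Q Y)"
      by (rule Q_arrI[OF Q_arrD(1)[OF \<phi>] Q_arrD(2)[OF \<psi>]]) simp_all
    then show ?thesis by (simp add: eq Q_Hom_iff)
  qed
  show "Cmp (Q Y) t (Id (Q Y) A) = t" "Cmp (Q Y) (Id (Q Y) B) t = t" if "t \<in> Hom (Q Y) A B" for t A B
    using that Q_arrD(3-5) by (auto simp: Q_Hom_iff)
  show "Cmp (Q Y) (Cmp (Q Y) t s) r = Cmp (Q Y) t (Cmp (Q Y) s r)"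
    if "r \<in> Hom (Q Y) A B" "s \<in> Hom (Q Y) B D" "t \<in> Hom (Q Y) D E" for r s t A B D E
    using that Q_arrD(3-5) by (auto simp: Q_Hom_iff)
qed

text \<open>
  The inverse \<open>\<psi>\<close> is automatically a morphism of \<open>Q Y\<close>: every \<open>u\<close> is \<open>\<phi> (\<psi> u)\<close>, and \<open>\<phi>\<close> respects all
  the structure.
\<close>

lemma Q_isoI:
  assumes \<phi>: "(A, \<phi>, B) \<in> Arr (Q Y)" and \<psi>: "\<psi> \<in> Arr C" "Dom C \<psi> = Tot B" "Cod C \<psi> = Tot A"
    and \<psi>\<phi>: "\<psi> \<cdot> \<phi> = Id C (Tot A)" and \<phi>\<psi>: "\<phi> \<cdot> \<psi> = Id C (Tot B)"
  shows "is_iso (Q Y) (A, \<phi>, B)"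
proof -
  note A = Q_arrD(1)[OF \<phi>] and B = Q_arrD(2)[OF \<phi>]
  note [simp] = Q_arrD(3-7)[OF \<phi>] Q_objD[OF A] Q_objD[OF B] \<psi>
  have [simp]: "\<psi> \<cdot> (\<phi> \<cdot> w) = w" if "w \<in> Arr C" "Cod C w = Tot A" for w
    using comp_eq_extend[OF \<psi>\<phi>, of w] that by simp
  have [simp]: "\<phi> \<cdot> (\<psi> \<cdot> w) = w" if "w \<in> Arr C" "Cod C w = Tot B" for w
    using comp_eq_extend[OF \<phi>\<psi>, of w] that by simp
  have "(B, \<psi>, A) \<in> Arr (Q Y)"
  proof (rule Q_arrI[OF B A])
    show "Proj A \<cdot> \<psi> = Proj B"
      using comp_eq_extend[OF Q_arrD(6)[OF \<phi>], of \<psi>] by (simp add: \<phi>\<psi>)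
    show "Map A \<cdot> \<psi> = Map B"
      using comp_eq_extend[OF Q_arrD(7)[OF \<phi>], of \<psi>] by (simp add: \<phi>\<psi>)
    fix a u assume au: "element_pair a u (Tot B)"
    then have "Act B \<cdot> pairing C a u = \<phi> \<cdot> (Act A \<cdot> pairing C a (\<psi> \<cdot> u))"
      using Q_arrD(10)[OF \<phi>, of a "\<psi> \<cdot> u"] by simp
    then show "\<psi> \<cdot> (Act B \<cdot> pairing C a u) = Act A \<cdot> pairing C a (\<psi> \<cdot> u)"
      using au by simp
  qed simp_all
  then show ?thesis
    using \<phi> \<psi>\<phi> \<phi>\<psi> unfolding is_iso_def
    by (intro conjI bexI[of _ "(B, \<psi>, A)"]) (auto simp: Q_Hom_iff)
qed


section \<open>Base change functors and coherence\<close>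

lemma qpull_obj_simps [simp]:
  "Tot (qpull_obj C G f A) = pbo C (Proj A) f"
  "Act (qpull_obj C G f A) = pulled_action (Act A) (Proj A) f"
  "Proj (qpull_obj C G f A) = Pb2 C (Proj A) f"
  "Map (qpull_obj C G f A) = Map A \<cdot> Pb1 C (Proj A) f"
  by (simp_all add: qpull_obj_def)

lemma qpull_simps [simp]:
  "OMap (qpull C G f) A = qpull_obj C G f A"
  "AMap (qpull C G f) (A, \<phi>, B) = (qpull_obj C G f A,
    pb_lift C (Proj B) f (\<phi> \<cdot> Pb1 C (Proj A) f) (Pb2 C (Proj A) f), qpull_obj C G f B)"
  by (simp_all add: qpull_def)

lemma qpull_obj_in:
  assumes A: "A \<in> Obj (Q Y)" and f: "f \<in> Hom C Z Y"
  shows "qpull_obj C G f A \<in> Obj (Q Z)"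
proof -
  have f': "f \<in> Arr C" "Dom C f = Z" "Cod C f = Y" using f by (simp_all add: Hom_iff)
  note a = Q_objD[OF A]
  have cod: "Cod C f = Cod C (Proj A)" using f' a by simp
  note [simp] = a f' pulled_action_props[OF a(11) f'(1) cod, unfolded f'(2)]
  have "locally_trivial C \<tau> G m (Dom C f) (pulled_action (Act A) (Proj A) f) (Pb2 C (Proj A) f)"
    by (rule locally_trivial_pullback[OF grothendieck_topology_axioms a(11) f'(1) cod])
      (use A[simplified, unfolded qobj_iff[OF action]] in simp)
  then show ?thesis
    using G_space_over_pullback[OF a(11) f'(1) cod] by (simp add: qobj_iff[OF action])
qed

lemma qpull_arr_in:
  assumes t: "(A, \<phi>, B) \<in> Arr (Q Y)" and f: "f \<in> Hom C Z Y"
  shows "AMap (qpull C G f) (A, \<phi>, B) \<in> Arr (Q Z)"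
proof -
  have f': "f \<in> Arr C" "Dom C f = Z" "Cod C f = Y" using f by (simp_all add: Hom_iff)
  note A = Q_arrD(1)[OF t] and B = Q_arrD(2)[OF t]
  note [simp] = Q_arrD(3-)[OF t] Q_objD[OF A] Q_objD[OF B] f'
    pulled_action_props[OF Q_objD(11)[OF A], of f, unfolded f'(2)]
    pulled_action_props[OF Q_objD(11)[OF B], of f, unfolded f'(2)]
  let ?l = "pb_lift C (Proj B) f (\<phi> \<cdot> Pb1 C (Proj A) f) (Pb2 C (Proj A) f)"
  have "(qpull_obj C G f A, ?l, qpull_obj C G f B) \<in> Arr (Q Z)"
  proof (rule Q_arrI[OF qpull_obj_in[OF A f] qpull_obj_in[OF B f]])
    fix a u assume "element_pair a u (Tot (qpull_obj C G f A))"
    then show "?l \<cdot> (Act (qpull_obj C G f A) \<cdot> pairing C a u)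
        = Act (qpull_obj C G f B) \<cdot> pairing C a (?l \<cdot> u)"
      by (intro pb_eqI[of "Proj B" f "?l \<cdot> _", rotated 10]) simp_all
  qed simp_all
  then show ?thesis by simp
qed

lemma qpull_functor:
  assumes f: "f \<in> Hom C Z Y"
  shows "is_functor (Q Y) (Q Z) (qpull C G f)"
proof -
  interpret QY: category "Q Y" by (rule Q_category)
  interpret QZ: category "Q Z" by (rule Q_category)
  have [simp]: "f \<in> Arr C" "Dom C f = Z" "Cod C f = Y" using f by (simp_all add: Hom_iff)
  show ?thesis
  proof
    show "OMap (qpull C G f) A \<in> Obj (Q Z)" if "A \<in> Obj (Q Y)" for A
      using qpull_obj_in[OF that f] by simp
    show "AMap (qpull C G f) t \<in> Hom (Q Z) (OMap (qpull C G f) A) (OMap (qpull C G f) B)"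
      if "t \<in> Hom (Q Y) A B" for t A B
    proof -
      obtain \<phi> where "t = (A, \<phi>, B)" and t: "(A, \<phi>, B) \<in> Arr (Q Y)"
        using \<open>t \<in> _\<close> by (auto simp: Q_Hom_iff)
      then show ?thesis using qpull_arr_in[OF t f] by (simp add: Q_Hom_iff)
    qed
    show "AMap (qpull C G f) (Id (Q Y) A) = Id (Q Z) (OMap (qpull C G f) A)"
      if A: "A \<in> Obj (Q Y)" for A
    proof -
      note [simp] = Q_objD[OF A]
      have "pb_lift C (Proj A) f (Id C (Tot A) \<cdot> Pb1 C (Proj A) f) (Pb2 C (Proj A) f)
          = Id C (pbo C (Proj A) f)"
        by (rule pb_eqI[of "Proj A" f]) simp_all
      then show ?thesis by simp
    qed
    show "AMap (qpull C G f) (Cmp (Q Y) t s) = Cmp (Q Z) (AMap (qpull C G f) t) (AMap (qpull C G f) s)"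
      if s: "s \<in> Hom (Q Y) A B" and t: "t \<in> Hom (Q Y) B D" for s t A B D
    proof -
      obtain \<phi> \<psi> where eq: "s = (A, \<phi>, B)" "t = (B, \<psi>, D)"
        and \<phi>: "(A, \<phi>, B) \<in> Arr (Q Y)" and \<psi>: "(B, \<psi>, D) \<in> Arr (Q Y)"
        using s t by (auto simp: Q_Hom_iff)
      note [simp] = Q_arrD(3-)[OF \<phi>] Q_arrD(3-)[OF \<psi>] Q_objD[OF Q_arrD(1)[OF \<phi>]]
        Q_objD[OF Q_arrD(2)[OF \<phi>]] Q_objD[OF Q_arrD(2)[OF \<psi>]]
      show ?thesis by (simp add: eq)
    qed
  qed
qed

lemma qunit_natural_iso:
  assumes Y: "Y \<in> Obj C"
  shows "natural_iso (Q Y) (Q Y) id_functor (qpull C G (Id C Y)) (qunit C G Y)"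
proof -
  have idY: "Id C Y \<in> Hom C Y Y" using Y by (simp add: Hom_iff)
  interpret I: is_functor "Q Y" "Q Y" id_functor by (rule functor_id[OF Q_category])
  interpret K: is_functor "Q Y" "Q Y" "qpull C G (Id C Y)" by (rule qpull_functor[OF idY])
  note [simp] = Y
  have unit: "qunit C G Y A \<in> Arr (Q Y)" "is_iso (Q Y) (qunit C G Y A)" if A: "A \<in> Obj (Q Y)" for A
  proof -
    note [simp] = Q_objD[OF A] pulled_action_props[OF Q_objD(11)[OF A], of "Id C Y", simplified]
    let ?l = "pb_lift C (Proj A) (Id C Y) (Id C (Tot A)) (Proj A)"
    have t: "(A, ?l, qpull_obj C G (Id C Y) A) \<in> Arr (Q Y)"
    proof (rule Q_arrI[OF A qpull_obj_in[OF A idY]])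
      fix a u assume "element_pair a u (Tot A)"
      then show "?l \<cdot> (Act A \<cdot> pairing C a u)
          = Act (qpull_obj C G (Id C Y) A) \<cdot> pairing C a (?l \<cdot> u)"
        by (intro pb_eqI[of "Proj A" "Id C Y" "?l \<cdot> _", rotated 10]) simp_all
    qed simp_all
    \<comment> \<open>the first projection \<open>P \<times>\<^sub>Y Y \<rightarrow> P\<close> inverts the unit\<close>
    have "?l \<cdot> Pb1 C (Proj A) (Id C Y) = Id C (pbo C (Proj A) (Id C Y))"
      by (rule pb_eqI[of "Proj A" "Id C Y"]) simp_all
    then have "is_iso (Q Y) (A, ?l, qpull_obj C G (Id C Y) A)"
      by (intro Q_isoI[OF t, of "Pb1 C (Proj A) (Id C Y)"]) simp_all
    with t show "qunit C G Y A \<in> Arr (Q Y)" "is_iso (Q Y) (qunit C G Y A)"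
      unfolding qunit_def by simp_all
  qed
  show ?thesis
  proof
    show "qunit C G Y A \<in> Hom (Q Y) (OMap id_functor A) (OMap (qpull C G (Id C Y)) A)"
      if "A \<in> Obj (Q Y)" for A
      using unit[OF that] by (simp add: Q_Hom_iff qunit_def id_functor_def)
    show "is_iso (Q Y) (qunit C G Y A)" if "A \<in> Obj (Q Y)" for A
      by (rule unit(2)[OF that])
    show "Cmp (Q Y) (qunit C G Y B) (AMap id_functor t)
        = Cmp (Q Y) (AMap (qpull C G (Id C Y)) t) (qunit C G Y A)"
      if "t \<in> Hom (Q Y) A B" for t A B
    proof -
      obtain \<phi> where eq: "t = (A, \<phi>, B)" and \<phi>: "(A, \<phi>, B) \<in> Arr (Q Y)"
        using \<open>t \<in> _\<close> by (auto simp: Q_Hom_iff)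
      note [simp] = Q_arrD(3-)[OF \<phi>] Q_objD[OF Q_arrD(1)[OF \<phi>]]
        Q_objD[OF Q_arrD(2)[OF \<phi>]]
      show ?thesis by (simp add: eq qunit_def id_functor_def)
    qed
  qed
qed

lemma qcomp_natural_iso:
  assumes f: "f \<in> Hom C Z Y" and g: "g \<in> Hom C W Z"
  shows "natural_iso (Q Y) (Q W) (comp_functor (qpull C G g) (qpull C G f)) (qpull C G (f \<cdot> g))
    (qcomp C G g f)"
proof -
  have fg: "f \<cdot> g \<in> Hom C W Y" using comp_in[OF g f] .
  have f' [simp]: "f \<in> Arr C" "Dom C f = Z" "Cod C f = Y" using f by (simp_all add: Hom_iff)
  have g' [simp]: "g \<in> Arr C" "Dom C g = W" "Cod C g = Z" using g by (simp_all add: Hom_iff)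
  interpret I: is_functor "Q Y" "Q W" "comp_functor (qpull C G g) (qpull C G f)"
    by (rule functor_comp[OF qpull_functor[OF f] qpull_functor[OF g]])
  interpret K: is_functor "Q Y" "Q W" "qpull C G (f \<cdot> g)" by (rule qpull_functor[OF fg])
  have comp: "qcomp C G g f A \<in> Arr (Q W)" "is_iso (Q W) (qcomp C G g f A)" if A: "A \<in> Obj (Q Y)" for A
  proof -
    note [simp] = Q_objD[OF A]
    note B = qpull_obj_in[OF A f]
    define c where "c = pb_lift C (Proj A) (f \<cdot> g) (Pb1 C (Proj A) f \<cdot> Pb1 C (Pb2 C (Proj A) f) g)
      (Pb2 C (Pb2 C (Proj A) f) g)"
    define d where "d = pb_lift C (Pb2 C (Proj A) f) g
      (pb_lift C (Proj A) f (Pb1 C (Proj A) (f \<cdot> g)) (g \<cdot> Pb2 C (Proj A) (f \<cdot> g)))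
      (Pb2 C (Proj A) (f \<cdot> g))"
    have "Cod C f = Cod C (Proj A)" "Cod C g = Dom C f" by simp_all
    note cd = iterated_pullback[OF Q_objD(11)[OF A] f'(1) this(1) g'(1) this(2), folded c_def d_def]
    have t: "(qpull_obj C G g (qpull_obj C G f A), c, qpull_obj C G (f \<cdot> g) A) \<in> Arr (Q W)"
    proof (rule Q_arrI[OF qpull_obj_in[OF B g] qpull_obj_in[OF A fg]])
      fix a u assume "element_pair a u (Tot (qpull_obj C G g (qpull_obj C G f A)))"
      then show "c \<cdot> (Act (qpull_obj C G g (qpull_obj C G f A)) \<cdot> pairing C a u)
          = Act (qpull_obj C G (f \<cdot> g) A) \<cdot> pairing C a (c \<cdot> u)"
        using cd(11)[of a u] by simp
    qed (simp_all add: cd(1-3,9,10))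
    then have "is_iso (Q W) (qpull_obj C G g (qpull_obj C G f A), c, qpull_obj C G (f \<cdot> g) A)"
      by (rule Q_isoI[of _ _ _ _ d]) (simp_all add: cd)
    with t show "qcomp C G g f A \<in> Arr (Q W)" "is_iso (Q W) (qcomp C G g f A)"
      unfolding qcomp_def c_def by simp_all
  qed
  show ?thesis
  proof
    show "qcomp C G g f A \<in> Hom (Q W) (OMap (comp_functor (qpull C G g) (qpull C G f)) A)
        (OMap (qpull C G (f \<cdot> g)) A)" if "A \<in> Obj (Q Y)" for A
      using comp[OF that] by (simp add: Q_Hom_iff qcomp_def comp_functor_def)
    show "is_iso (Q W) (qcomp C G g f A)" if "A \<in> Obj (Q Y)" for A
      by (rule comp(2)[OF that])
    show "Cmp (Q W) (qcomp C G g f B) (AMap (comp_functor (qpull C G g) (qpull C G f)) t)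
        = Cmp (Q W) (AMap (qpull C G (f \<cdot> g)) t) (qcomp C G g f A)"
      if "t \<in> Hom (Q Y) A B" for t A B
    proof -
      obtain \<phi> where eq: "t = (A, \<phi>, B)" and \<phi>: "(A, \<phi>, B) \<in> Arr (Q Y)"
        using \<open>t \<in> _\<close> by (auto simp: Q_Hom_iff)
      note [simp] = Q_arrD(3-)[OF \<phi>] Q_objD[OF Q_arrD(1)[OF \<phi>]]
        Q_objD[OF Q_arrD(2)[OF \<phi>]]
      show ?thesis by (simp add: eq qcomp_def comp_functor_def)
    qed
  qed
qed

text \<open>
  The coherence laws become equalities of lifts into one pullback. Both sides of the associativity law
  are the same lift once composites are pushed inside, and in both unit laws the left side is the lift
  of the two projections, which is the identity.
\<close>

lemma quotient_prestack_pseudofunctor: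
  "pseudofunctor_to_Cat (op_cat C) (quotient_prestack C \<tau> G m e X x)"
proof -
  have [simp]: "f \<in> Hom (op_cat C) a b \<longleftrightarrow> f \<in> Hom C b a" for f a b
    by (auto simp: Hom_def op_cat_def)
  have op [simp]: "Obj (op_cat C) = Obj C" "Id (op_cat C) = Id C" "g \<cdot>\<^bsub>op_cat C\<^esub> f = f \<cdot> g" for f g
    by (simp_all add: op_cat_def)
  have [simp]: "PObj (quotient_prestack C \<tau> G m e X x) = Q"
    "PArr (quotient_prestack C \<tau> G m e X x) = qpull C G"
    "PUnit (quotient_prestack C \<tau> G m e X x) = qunit C G"
    "PComp (quotient_prestack C \<tau> G m e X x) = qcomp C G"
    by (simp_all add: quotient_prestack_def)
  interpret op: category "op_cat C"
  proof
    show "Dom (op_cat C) f \<in> Obj (op_cat C)" "Cod (op_cat C) f \<in> Obj (op_cat C)"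
      if "f \<in> Arr (op_cat C)" for f
      using that by (simp_all add: op_cat_def)
  qed (auto simp: Hom_iff)
  show ?thesis
  proof (intro pseudofunctor_to_Cat.intro pseudofunctor_to_Cat_axioms.intro)
    fix Y Z f A assume f: "f \<in> Hom (op_cat C) Y Z" and A: "A \<in> Obj (PObj (quotient_prestack C \<tau> G m e X x) Y)"
    then have A': "A \<in> Obj (Q Y)" by simp
    have [simp]: "f \<in> Arr C" "Dom C f = Z" "Cod C f = Y" using f by (simp_all add: Hom_iff)
    have [simp]: "Y \<in> Obj C" "Z \<in> Obj C" using dom_obj[of f] cod_obj[of f] by simp_all
    note [simp] = Q_objD[OF A']
    have "pb_lift C (Proj A) f (Pb1 C (Proj A) f) (Pb2 C (Proj A) f) = Id C (pbo C (Proj A) f)"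
      by (rule pb_eqI[of "Proj A" f]) simp_all
    then show "PComp (quotient_prestack C \<tau> G m e X x) f (Id (op_cat C) Y) A
        \<cdot>\<^bsub>PObj (quotient_prestack C \<tau> G m e X x) Z\<^esub>
        AMap (PArr (quotient_prestack C \<tau> G m e X x) f) (PUnit (quotient_prestack C \<tau> G m e X x) Y A)
      = Id (PObj (quotient_prestack C \<tau> G m e X x) Z) (OMap (PArr (quotient_prestack C \<tau> G m e X x) f) A)"
      "PComp (quotient_prestack C \<tau> G m e X x) (Id (op_cat C) Z) f A
        \<cdot>\<^bsub>PObj (quotient_prestack C \<tau> G m e X x) Z\<^esub>
        PUnit (quotient_prestack C \<tau> G m e X x) Z (OMap (PArr (quotient_prestack C \<tau> G m e X x) f) A)
      = Id (PObj (quotient_prestack C \<tau> G m e X x) Z) (OMap (PArr (quotient_prestack C \<tau> G m e X x) f) A)"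
      by (simp_all add: qunit_def qcomp_def)
  next
    fix Y Z W V f g h A
    assume f: "f \<in> Hom (op_cat C) Y Z" and g: "g \<in> Hom (op_cat C) Z W" and h: "h \<in> Hom (op_cat C) W V"
      and A: "A \<in> Obj (PObj (quotient_prestack C \<tau> G m e X x) Y)"
    then have A': "A \<in> Obj (Q Y)" by simp
    have [simp]: "f \<in> Arr C" "Dom C f = Z" "Cod C f = Y" "g \<in> Arr C" "Dom C g = W" "Cod C g = Z"
      "h \<in> Arr C" "Dom C h = V" "Cod C h = W"
      using f g h by (simp_all add: Hom_iff)
    note [simp] = Q_objD[OF A']
    show "PComp (quotient_prestack C \<tau> G m e X x) (h \<cdot>\<^bsub>op_cat C\<^esub> g) f A
        \<cdot>\<^bsub>PObj (quotient_prestack C \<tau> G m e X x) V\<^esub>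
        PComp (quotient_prestack C \<tau> G m e X x) h g (OMap (PArr (quotient_prestack C \<tau> G m e X x) f) A)
      = PComp (quotient_prestack C \<tau> G m e X x) h (g \<cdot>\<^bsub>op_cat C\<^esub> f) A
        \<cdot>\<^bsub>PObj (quotient_prestack C \<tau> G m e X x) V\<^esub>
        AMap (PArr (quotient_prestack C \<tau> G m e X x) h) (PComp (quotient_prestack C \<tau> G m e X x) g f A)"
      by (simp add: qcomp_def)
  qed (simp_all add: op.category_axioms Q_category qpull_functor qunit_natural_iso qcomp_natural_iso)
qed

end

theorem proposition3p4:
  fixes C :: "('o, 'a) pbcat"
    and \<tau> :: "'o \<Rightarrow> 'a set set"
    and G X :: 'o
    and m e x :: 'a
  assumes "category_with_pullbacks_and_terminal C"
    and "grothendieck_topology C \<tau>"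
    and "group_object C G m e"
    and "group_action C G m e X x"
  shows "pseudofunctor_to_Cat (op_cat C) (quotient_prestack C \<tau> G m e X x)"
proof -
  interpret category_with_pullbacks_and_terminal C by fact
  interpret grothendieck_topology C \<tau> by fact
  interpret quotient_setting C \<tau> G m e X x
    by unfold_locales (fact assms)+
  show ?thesis by (rule quotient_prestack_pseudofunctor)
qed

end
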